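(* Let $\sigma\in\mathcal{M}^+(\mathbb{R}^{n+1}_+)$, and let $0<q<1$. There exists a constant $\varkappa>0$ such that $$\|\mathbf{P}\nu\|_{L^q(\mathbb{R}^{n+1}_+,\sigma)}\le\varkappa\,\|\nu\|\quad\text{for all }\nu\in\mathcal{M}^+(\mathbb{R}^n)\qquad( * )$$ if and only if there exists a function $u>0$ such that $$u\in L^q(\mathbb{R}^{n+1}_+,\sigma)\quad\text{and}\quad u\ge\mathbf{P}\mathbf{P}^*(u^q\,d\sigma)\ \text{ in }\mathbb{R}^{n+1}_+.$$ Moreover, if $( * )$ holds, then a positive solution $u=\mathbf{P}\mathbf{P}^*(u^q\,d\sigma)$ such that $u\in L^q(\mathbb{R}^{n+1}_+,\sigma)$ can be constructed as follows: $u=\lim_{j\to\infty}u_j$, where $$u_0:=c_0\,(\mathbf{P}\mathbf{P}^*\sigma)^{\frac1{1-q}},\qquad u_{j+1}:=\mathbf{P}\mathbf{P}^*(u_j^q\,d\sigma),\quad j=0,1,\dots,$$ for a small enough constant $c_0>0$ (depending only on $q$ and $n$), which ensures that $u_{j+1}\ge u_j$. In particular, $u\ge c_0\,(\mathbf{P}\mathbf{P}^*\sigma)^{\frac1{1-q}}$.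
   Context: $\mathbb{R}^{n+1}_+=\{(x,y):x\in\mathbb{R}^n,\ y>0\}$. $\mathcal{M}^+(X)$ is the class of nonnegative locally finite Borel measures on $X$, and $\|\nu\|=\nu(\mathbb{R}^n)$ for $\nu\in\mathcal{M}^+(\mathbb{R}^n)$. $P(x,y)=c_n\,y\,(|x|^2+y^2)^{-\frac{n+1}2}$ is the Poisson kernel of $\mathbb{R}^{n+1}_+$, with $c_n$ chosen so that $\int_{\mathbb{R}^n}P(x,y)\,dx=1$ for $y>0$. For $\nu\in\mathcal{M}^+(\mathbb{R}^n)$, $\mathbf{P}\nu(x,y)=\int_{\mathbb{R}^n}P(x-t,y)\,d\nu(t)$. For $\mu\in\mathcal{M}^+(\mathbb{R}^{n+1}_+)$, $\mathbf{P}^*\mu(t)=\int_{\mathbb{R}^{n+1}_+}P(x-t,y)\,d\mu(x,y)$, $t\in\mathbb{R}^n$, and $\mathbf{P}\mathbf{P}^*\mu(x,y)=\mathbf{P}[(\mathbf{P}^*\mu)\,dt](x,y)=\int_{\mathbb{R}^{n+1}_+}P(x-\tilde x,y+\tilde y)\,d\mu(\tilde x,\tilde y)$.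
   Formalization: Positivity of the constructed solution u is asserted only when σ is not the zero measure: for σ = 0, ( * ) holds trivially but the only solution of u = PP*(u^q dσ) is u = 0; all other claims are kept for every σ. *)

theory Defs
  imports "HOL-Analysis.Analysis"
begin

text \<open>The space \<open>\<real>\<^sup>n\<close> is a type \<open>'a::euclidean_space\<close> with \<open>n = DIM('a)\<close>. All potentials take
  values in \<open>[0, \<infinity>]\<close>, i.e. in \<^typ>\<open>ennreal\<close>.\<close>

definition halfspace :: "('a::euclidean_space \<times> real) set" where
  "halfspace = {(x, y). y > 0}"

text \<open>Nonnegative locally finite Borel measures on \<open>X\<close>; such a measure has \<open>space \<mu> = X\<close>, and
  local finiteness is relative to \<open>X\<close> (it says nothing about boundary points of \<open>X\<close>).\<close>

definition locally_finite_borel_measures :: "'z::topological_space set \<Rightarrow> 'z measure set" where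
  "locally_finite_borel_measures X =
    {\<mu>. sets \<mu> = sets (restrict_space borel X) \<and>
        (\<forall>x\<in>X. \<exists>U. open U \<and> x \<in> U \<and> emeasure \<mu> (U \<inter> X) < \<infinity>)}"

text \<open>Used for \<open>a > 0\<close> only, so that \<open>0\<close> is mapped to \<open>0\<close> and \<open>\<infinity>\<close> to \<open>\<infinity>\<close>.\<close>

definition epowr :: "ennreal \<Rightarrow> real \<Rightarrow> ennreal" where
  "epowr x a = (if x = \<infinity> then \<infinity> else ennreal (enn2real x powr a))"

definition Lq_norm :: "real \<Rightarrow> 'z measure \<Rightarrow> ('z \<Rightarrow> ennreal) \<Rightarrow> ennreal" where
  "Lq_norm q \<sigma> f = epowr (\<integral>\<^sup>+ z. epowr (f z) q \<partial>\<sigma>) (1 / q)"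

definition in_Lq :: "real \<Rightarrow> 'z measure \<Rightarrow> ('z \<Rightarrow> ennreal) \<Rightarrow> bool" where
  "in_Lq q \<sigma> f \<longleftrightarrow> f \<in> borel_measurable \<sigma> \<and> Lq_norm q \<sigma> f < \<infinity>"

definition poisson_profile :: "'a::euclidean_space \<Rightarrow> real \<Rightarrow> real" where
  "poisson_profile x y = y * ((norm x)\<^sup>2 + y\<^sup>2) powr (- (real DIM('a) + 1) / 2)"

definition poisson_const :: "'a::euclidean_space itself \<Rightarrow> real" where
  "poisson_const _ = (THE c. \<forall>y>0. (LINT x|lborel. c * poisson_profile (x :: 'a) y) = 1)"

definition poisson_kernel :: "'a::euclidean_space \<Rightarrow> real \<Rightarrow> real" where
  "poisson_kernel x y = poisson_const TYPE('a) * poisson_profile x y"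

text \<open>The constant above is well defined: the normalisation holds for all \<open>y > 0\<close> at once, and
  the kernel is integrable, so that the (total) integral is the genuine one.\<close>

lemma integrable_poisson_profile_1: "integrable lborel (\<lambda>x::'a::euclidean_space. poisson_profile x 1)"
proof -
  let ?n = "real DIM('a)"
  define V where "V = unit_ball_vol ?n"
  have V0: "V \<ge> 0" unfolding V_def by simp
  define a :: "nat \<Rightarrow> real" where "a k = (2 powr (real k - 1)) powr (- (?n + 1))" for k
  have a0: "a k \<ge> 0" for k unfolding a_def by simp
  have bound: "ennreal (poisson_profile x 1) \<le> (\<Sum>k. ennreal (a k) * indicator (cball 0 (2^k)) x)" for x :: 'a
  proof -
    have ex: "\<exists>k. poisson_profile x 1 \<le> a k \<and> norm x \<le> 2 ^ k"
    proof (cases "norm x \<le> 1")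
      case True
      have "poisson_profile x 1 \<le> 1"
        using powr_mono[of "- (?n + 1) / 2" 0 "(norm x)\<^sup>2 + 1"]
        by (simp add: poisson_profile_def add_nonneg_eq_0_iff)
      moreover have "1 \<le> a 0"
      proof -
        have "a 0 = 2 powr (?n + 1)"
          unfolding a_def by (simp only: powr_powr) (simp add: add.commute)
        thus ?thesis by (simp add: ge_one_powr_ge_zero)
      qed
      ultimately show ?thesis using True by (intro exI[of _ 0]) auto
    next
      case False
      define k where "k = (LEAST k::nat. norm x \<le> 2 ^ k)"
      obtain m :: nat where "norm x < 2 ^ m" using real_arch_pow[of 2 "norm x"] by auto
      hence k1: "norm x \<le> 2 ^ k" unfolding k_def by (rule LeastI[where k=m, OF less_imp_le])
      have "k \<noteq> 0" using k1 False by (cases k) auto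
      then obtain j where j: "k = Suc j" by (cases k) auto
      have "\<not> norm x \<le> 2 ^ j" using not_less_Least[of j "\<lambda>k. norm x \<le> 2 ^ k"] j k_def by auto
      hence x: "2 ^ j < norm x" by simp
      have "poisson_profile x 1 \<le> ((norm x)\<^sup>2) powr (- (?n + 1) / 2)"
        unfolding poisson_profile_def using False by (simp, intro powr_mono2') auto
      also have "\<dots> = norm x powr (- (?n + 1))"
      proof -
        have "(norm x)\<^sup>2 = norm x powr 2" using False by (simp add: powr_numeral)
        hence "((norm x)\<^sup>2) powr (- (?n + 1) / 2) = norm x powr (2 * (- (?n + 1) / 2))"
          by (simp only: powr_powr)
        thus ?thesis by (simp only: times_divide_eq_right nonzero_mult_div_cancel_left)
      qed
      also have "\<dots> \<le> (2 ^ j) powr (- (?n + 1))"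
        using x by (intro powr_mono2') auto
      also have "\<dots> = a k" unfolding a_def j by (simp add: powr_realpow)
      finally show ?thesis using k1 by auto
    qed
    then obtain k where k: "poisson_profile x 1 \<le> a k" "norm x \<le> 2 ^ k" by auto
    have "ennreal (poisson_profile x 1) \<le> ennreal (a k) * indicator (cball 0 (2^k)) x"
      using k by (simp add: indicator_def ennreal_leI)
    also have "\<dots> \<le> (\<Sum>k. ennreal (a k) * indicator (cball 0 (2^k)) x)"
      using sum_le_suminf[of "\<lambda>i. ennreal (a i) * indicator (cball 0 (2^i)) x" "{k}"]
      by (simp del: sum_mult_indicator)
    finally show ?thesis .
  qed
  have "(\<integral>\<^sup>+ x. ennreal (poisson_profile (x::'a) 1) \<partial>lborel)
      \<le> (\<integral>\<^sup>+ x. (\<Sum>k. ennreal (a k) * indicator (cball (0::'a) (2^k)) x) \<partial>lborel)"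
    by (intro nn_integral_mono bound)
  also have "\<dots> = (\<Sum>k. \<integral>\<^sup>+ x. ennreal (a k) * indicator (cball (0::'a) (2^k)) x \<partial>lborel)"
    by (intro nn_integral_suminf borel_measurable_times_ennreal borel_measurable_indicator) simp_all
  also have "\<dots> = (\<Sum>k. ennreal (V * 2 powr (?n + 1) * (1/2) ^ k))"
  proof (intro suminf_cong)
    fix k :: nat
    have "(\<integral>\<^sup>+ x. ennreal (a k) * indicator (cball (0::'a) (2^k)) x \<partial>lborel)
        = ennreal (a k) * ennreal (V * (2 ^ k) ^ DIM('a))"
      by (subst nn_integral_cmult_indicator) (simp_all add: emeasure_cball V_def)
    also have "\<dots> = ennreal (V * (a k * (2 ^ k) ^ DIM('a)))"
      using a0 V0 by (simp add: ennreal_mult[symmetric] mult_ac)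
    also have "a k * (2 ^ k) ^ DIM('a) = 2 powr (?n + 1) * (1/2) ^ k"
    proof -
      have "(2 ^ k) ^ DIM('a) = (2::real) powr (real k * ?n)"
        by (simp add: powr_powr[symmetric] powr_realpow)
      moreover have "(1/2::real) ^ k = 2 powr (- real k)"
        by (simp add: powr_minus powr_realpow power_one_over divide_simps)
      moreover have "a k = 2 powr (- (real k - 1) * (?n + 1))"
        unfolding a_def by (simp add: powr_powr algebra_simps)
      ultimately show ?thesis by (simp add: powr_add[symmetric] algebra_simps)
    qed
    finally show "(\<integral>\<^sup>+ x. ennreal (a k) * indicator (cball (0::'a) (2^k)) x \<partial>lborel)
        = ennreal (V * 2 powr (?n + 1) * (1/2) ^ k)" by (simp add: mult_ac)
  qed
  also have "\<dots> < \<infinity>"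
  proof -
    have "summable (\<lambda>k. V * 2 powr (?n + 1) * (1/2::real) ^ k)"
      by (intro summable_mult summable_geometric) auto
    thus ?thesis using V0 by (subst suminf_ennreal2) auto
  qed
  finally have fin: "(\<integral>\<^sup>+ x. ennreal (poisson_profile (x::'a) 1) \<partial>lborel) < \<infinity>" .
  show ?thesis
  proof (rule integrableI_nonneg)
    show "(\<lambda>x::'a. poisson_profile x 1) \<in> borel_measurable lborel"
      unfolding poisson_profile_def by measurable
    show "AE x in lborel. 0 \<le> poisson_profile (x::'a) 1"
      by (simp add: poisson_profile_def)
  qed (fact fin)
qed

lemma integral_poisson_profile:
  assumes "y > 0"
  shows "(LINT x|lborel. poisson_profile (x::'a::euclidean_space) y)
       = (LINT x|lborel. poisson_profile (x::'a) 1)"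
proof -
  have s: "y ^ DIM('a) * poisson_profile (y *\<^sub>R x) y = poisson_profile x 1" for x :: 'a
  proof -
    have e1: "(norm (y *\<^sub>R x))\<^sup>2 + y\<^sup>2 = y\<^sup>2 * ((norm x)\<^sup>2 + 1)"
      by (simp add: power_mult_distrib algebra_simps)
    have e2: "y\<^sup>2 powr (- (real DIM('a) + 1) / 2) = y powr (- (real DIM('a) + 1))"
    proof -
      have "y\<^sup>2 = y powr 2" using assms by (simp add: powr_numeral)
      hence "y\<^sup>2 powr (- (real DIM('a) + 1) / 2) = y powr (2 * (- (real DIM('a) + 1) / 2))"
        by (simp only: powr_powr)
      thus ?thesis by (simp only: times_divide_eq_right nonzero_mult_div_cancel_left)
    qed
    have one: "y ^ DIM('a) * (y * y powr (- (real DIM('a) + 1))) = 1"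
    proof -
      have "y ^ DIM('a) * (y * y powr (- (real DIM('a) + 1)))
          = y powr (real DIM('a)) * (y powr 1 * y powr (- (real DIM('a) + 1)))"
        using assms by (simp add: powr_realpow)
      also have "\<dots> = 1" using assms by (simp only: powr_add[symmetric]) simp
      finally show ?thesis .
    qed
    have "poisson_profile (y *\<^sub>R x) y = y * (y powr (- (real DIM('a) + 1)) * poisson_profile x 1)"
      unfolding poisson_profile_def e1 powr_mult e2 by simp
    hence "y ^ DIM('a) * poisson_profile (y *\<^sub>R x) y
        = (y ^ DIM('a) * (y * y powr (- (real DIM('a) + 1)))) * poisson_profile x 1"
      by (simp only: mult.assoc)
    thus ?thesis by (simp only: one mult_1_left)
  qed
  have m: "(\<lambda>x::'a. poisson_profile x y) \<in> borel_measurable borel"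
    unfolding poisson_profile_def by measurable
  have "(LINT x|lborel. poisson_profile (x::'a) y)
      = (LINT x|density (distr lborel borel (\<lambda>x. 0 + y *\<^sub>R x)) (\<lambda>_. \<bar>y\<bar> ^ DIM('a)). poisson_profile (x::'a) y)"
    using assms by (subst lborel_affine[of y 0]) auto
  also have "\<dots> = (LINT x|lborel. y ^ DIM('a) * poisson_profile (y *\<^sub>R (x::'a)) y)"
    using assms m by (subst integral_density) (auto simp: integral_distr)
  finally show ?thesis by (simp add: s)
qed

lemma integral_poisson_profile_pos: "(LINT x|lborel. poisson_profile (x::'a::euclidean_space) 1) > 0"
proof -
  have p: "poisson_profile (x::'a) 1 > 0" for x
    unfolding poisson_profile_def by (simp add: add_nonneg_pos less_imp_neq[symmetric])
  have "(LINT x|lborel. poisson_profile (x::'a) 1) \<noteq> 0"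
  proof
    assume "(LINT x|lborel. poisson_profile (x::'a) 1) = 0"
    hence "AE x in lborel. poisson_profile (x::'a) 1 = 0"
      using integral_nonneg_eq_0_iff_AE[OF integrable_poisson_profile_1] p
      by (metis (mono_tags, lifting) AE_I2 less_imp_le)
    hence "AE x::'a in lborel. False" using p by (auto simp: less_imp_neq[symmetric])
    thus False by (simp add: AE_iff_null null_sets_def)
  qed
  moreover have "(LINT x|lborel. poisson_profile (x::'a) 1) \<ge> 0"
    using p by (intro integral_nonneg_AE) (auto intro: less_imp_le)
  ultimately show ?thesis by simp
qed

lemma poisson_const_eq:
  "poisson_const TYPE('a::euclidean_space) = 1 / (LINT x|lborel. poisson_profile (x::'a) 1)"
  unfolding poisson_const_def
proof (rule the_equality)
  let ?J = "LINT x|lborel. poisson_profile (x::'a) 1"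
  show "\<forall>y>0. (LINT x|lborel. 1 / ?J * poisson_profile (x::'a) y) = 1"
  proof (intro allI impI)
    fix y :: real assume "y > 0"
    have "(LINT x|lborel. 1 / ?J * poisson_profile (x::'a) y)
        = 1 / ?J * (LINT x|lborel. poisson_profile (x::'a) y)"
      by (rule integral_mult_right_zero)
    also have "\<dots> = 1"
      unfolding integral_poisson_profile[OF \<open>y > 0\<close>]
      using integral_poisson_profile_pos[where 'a='a] by simp
    finally show "(LINT x|lborel. 1 / ?J * poisson_profile (x::'a) y) = 1" .
  qed
  fix c :: real
  assume "\<forall>y>0. (LINT x|lborel. c * poisson_profile (x::'a) y) = 1"
  hence "c * (LINT x|lborel. poisson_profile (x::'a) 1) = 1" by (metis integral_mult_right_zero zero_less_one)
  thus "c = 1 / (LINT x|lborel. poisson_profile (x::'a) 1)"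
    using integral_poisson_profile_pos[where 'a='a] by (simp add: field_simps)
qed

lemma poisson_const_pos: "poisson_const TYPE('a::euclidean_space) > 0"
  using integral_poisson_profile_pos[where 'a='a] by (simp add: poisson_const_eq)

lemma integral_poisson_kernel:
  assumes "y > 0"
  shows "(LINT x|lborel. poisson_kernel (x::'a::euclidean_space) y) = 1"
proof -
  have "(LINT x|lborel. poisson_kernel (x::'a) y)
      = poisson_const TYPE('a) * (LINT x|lborel. poisson_profile (x::'a) y)"
    unfolding poisson_kernel_def by (rule integral_mult_right_zero)
  also have "\<dots> = 1"
    unfolding integral_poisson_profile[OF assms] poisson_const_eq
    using integral_poisson_profile_pos[where 'a='a] by simp
  finally show ?thesis .
qed

definition poisson :: "'a::euclidean_space measure \<Rightarrow> 'a \<times> real \<Rightarrow> ennreal" where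
  "poisson \<nu> = (\<lambda>(x, y). \<integral>\<^sup>+ t. ennreal (poisson_kernel (x - t) y) \<partial>\<nu>)"

definition poisson_adj :: "('a::euclidean_space \<times> real) measure \<Rightarrow> 'a \<Rightarrow> ennreal" where
  "poisson_adj \<mu> = (\<lambda>t. \<integral>\<^sup>+ (x, y). ennreal (poisson_kernel (x - t) y) \<partial>\<mu>)"

definition poisson_poisson_adj ::
    "('a::euclidean_space \<times> real) measure \<Rightarrow> 'a \<times> real \<Rightarrow> ennreal" where
  "poisson_poisson_adj \<mu> = poisson (density lborel (poisson_adj \<mu>))"

definition power_measure :: "real \<Rightarrow> 'z measure \<Rightarrow> ('z \<Rightarrow> ennreal) \<Rightarrow> 'z measure" where
  "power_measure q \<sigma> u = density \<sigma> (\<lambda>z. epowr (u z) q)"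

definition poisson_trace_ineq ::
    "real \<Rightarrow> ('a::euclidean_space \<times> real) measure \<Rightarrow> real \<Rightarrow> bool" where
  "poisson_trace_ineq q \<sigma> \<kappa> \<longleftrightarrow>
    (\<forall>\<nu> \<in> locally_finite_borel_measures (UNIV :: 'a set).
       Lq_norm q \<sigma> (poisson \<nu>) \<le> ennreal \<kappa> * emeasure \<nu> UNIV)"

primrec poisson_iter ::
    "real \<Rightarrow> ('a::euclidean_space \<times> real) measure \<Rightarrow> real \<Rightarrow> nat \<Rightarrow> 'a \<times> real \<Rightarrow> ennreal" where
  "poisson_iter q \<sigma> c 0 =
     (\<lambda>z. ennreal c * epowr (poisson_poisson_adj \<sigma> z) (1 / (1 - q)))"
| "poisson_iter q \<sigma> c (Suc j) =
     poisson_poisson_adj (power_measure q \<sigma> (poisson_iter q \<sigma> c j))"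

end

theory Submission
  imports Defs
begin

text \<open>Up to constants the Poisson kernel is \<open>y / (|x| + y)^(n+1)\<close>, and the kernel of \<open>PP*\<close> is the same
  function of \<open>(x - x', y + y')\<close>. This kernel obeys a weak maximum principle: mass below a point \<open>z\<close> is
  averaged over the balls \<open>B(x', y')\<close> of the boundary, and is controlled by the mass in cones, hence by
  the potential near the lowest carrier point of each cone; mass above \<open>z\<close> is controlled by the
  potential at the carrier point nearest to \<open>z\<close>. Splitting \<open>\<sigma>\<close> at the level
  \<open>PP*\<sigma>(z) / (2h)\<close> then gives \<open>PP*((PP*\<sigma>)^s \<sigma>) \<ge> c (PP*\<sigma>)^(1+s)\<close>, which makes the iteration
  increasing. The trace inequality applied to \<open>P*(u^q \<sigma>) dt\<close> bounds every subsolution in \<open>L^q\<close>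
  by a power of \<open>\<kappa>\<close>, so the iteration converges.

  Conversely, let \<open>u \<ge> PP*(u^q \<sigma>)\<close> and \<open>\<omega> = u^q \<sigma>\<close>. On a finite net of the set \<open>{P\<nu> > l u}\<close> one finds
  a discrete measure \<open>\<eta>\<close> with \<open>P*\<eta>\<close> bounded and \<open>PP*\<eta>\<close> bounded below on the net. Integrating
  \<open>PP*\<omega> \<le> P\<nu> / l\<close> against \<open>\<eta>\<close> yields \<open>\<omega>{P\<nu> > l u} \<le> C |\<nu>| / l\<close>. Since \<open>\<omega>\<close> is finite and
  \<open>q < 1\<close>, this weak-type bound of \<open>P\<nu> / u\<close> integrates to the trace inequality.\<close>

section \<open>The Poisson kernel up to constants\<close>

text \<open>The kernel of \<open>PP*\<close> is not quasi-metric: two points at a small height e and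
  distance 1 have \<open>pp_cmp\<close> of order e, although \<open>pp_cmp\<close> between either of
  them and a nearby point at height 1 is bounded below. A triangle inequality alone therefore does
  not give the maximum principle, which is why mass below and mass above a point are treated
  separately, the former by way of the boundary. The level \<open>PP*\<sigma>(z) / (2h)\<close>,
  with h the constant of that principle, is the one below which the measure supplies at most half of
  \<open>PP*\<sigma>(z)\<close>. For \<open>s = q / (1 - q)\<close> the exponent
  \<open>1 + s = 1 / (1 - q)\<close> is the one of the first iterate, and "small enough" means
  \<open>c\<^sub>0 powr (1 - q) \<le> c\<close>. The measure \<eta> is a discrete stand-in for an
  equilibrium measure. Its atoms lie inside \<open>{P\<nu> > l u}\<close>, which matters because
  \<open>u\<close> is only measurable and its values cannot be compared at neighbouring points. An
  atom at height \<open>y\<close> has mass \<open>y^n\<close> or 0; mass \<open>y^n\<close> there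
  produces a potential of order 1 at the atom itself.\<close>

definition poisson_cmp :: "'a::euclidean_space \<Rightarrow> real \<Rightarrow> real" where
  "poisson_cmp x y = y / (norm x + y) ^ (DIM('a) + 1)"

definition pp_cmp :: "'a::euclidean_space \<times> real \<Rightarrow> 'a \<times> real \<Rightarrow> real" where
  "pp_cmp z w = poisson_cmp (fst z - fst w) (snd z + snd w)"

lemma poisson_cmp_pos: "y > 0 \<Longrightarrow> poisson_cmp x y > 0"
  unfolding poisson_cmp_def by (intro divide_pos_pos zero_less_power add_nonneg_pos) auto

lemma pp_cmp_pos: "snd z > 0 \<Longrightarrow> snd w > 0 \<Longrightarrow> pp_cmp z w > 0"
  unfolding pp_cmp_def by (intro poisson_cmp_pos) simp

lemma pp_cmp_sym: "pp_cmp z w = pp_cmp w z"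
  by (simp add: pp_cmp_def poisson_cmp_def norm_minus_commute add.commute)

text \<open>Most later comparisons of kernel values are instances of this: a bounds the ratio of the
  heights (numerators), b the ratio of the quantities norm plus height (denominators).\<close>

lemma poisson_cmp_le_poisson_cmp:
  fixes x x' :: "'a::euclidean_space"
  assumes "y > 0" "y' > 0" "a > 0" "b > 0" "y \<le> a * y'" "norm x' + y' \<le> b * (norm x + y)"
  shows "poisson_cmp x y \<le> a * b ^ (DIM('a) + 1) * poisson_cmp x' y'"
proof -
  let ?N = "DIM('a) + 1"
  have p: "norm x + y > 0" "norm x' + y' > 0" using assms by (auto intro: add_nonneg_pos)
  have "(norm x' + y') ^ ?N \<le> (b * (norm x + y)) ^ ?N"
    using assms p by (intro power_mono) auto
  hence "(norm x' + y') ^ ?N \<le> b ^ ?N * (norm x + y) ^ ?N" by (simp only: power_mult_distrib)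
  hence "y * (norm x' + y') ^ ?N \<le> (a * y') * (b ^ ?N * (norm x + y) ^ ?N)"
    using assms p by (intro mult_mono) (auto simp del: power_Suc)
  thus ?thesis unfolding poisson_cmp_def using p
    by (simp add: divide_simps zero_less_power mult_ac del: power_Suc)
qed

lemma poisson_cmp_le: "y > 0 \<Longrightarrow> poisson_cmp (x::'a::euclidean_space) y \<le> 1 / y ^ DIM('a)"
proof -
  assume y: "y > 0"
  have "y ^ (DIM('a) + 1) \<le> (norm x + y) ^ (DIM('a) + 1)"
    using y by (intro power_mono) auto
  hence "poisson_cmp x y \<le> y / y ^ (DIM('a) + 1)"
    unfolding poisson_cmp_def using y by (intro divide_left_mono mult_pos_pos zero_less_power add_nonneg_pos) auto
  also have "\<dots> = 1 / y ^ DIM('a)" using y by simp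
  finally show ?thesis .
qed

text \<open>Moving the evaluation point up from \<open>z\<close> to \<open>z'\<close> does not
  decrease the numerator, and the triangle inequality through \<open>fst z\<close> enlarges the
  denominator base by at most b + 1. It serves with \<open>z'\<close> an almost nearest carrier
  point above \<open>z\<close>.\<close>

lemma pp_cmp_triangle:
  assumes "snd z > 0" "snd w > 0" "snd z' > 0" "snd z \<le> snd z'"
    "norm (fst z - fst z') + snd z' \<le> b * (norm (fst z - fst w) + snd z + snd w)" "b > 0"
  shows "pp_cmp z w \<le> (b + 1) ^ (DIM('a) + 1) * pp_cmp z' (w::'a::euclidean_space \<times> real)"
proof -
  have "norm (fst z' - fst w) \<le> norm (fst z - fst z') + norm (fst z - fst w)"
    using norm_triangle_ineq[of "fst z' - fst z" "fst z - fst w"] by (simp add: norm_minus_commute)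
  hence "pp_cmp z w \<le> 1 * (b + 1) ^ (DIM('a) + 1) * pp_cmp z' w"
    unfolding pp_cmp_def using assms by (intro poisson_cmp_le_poisson_cmp) (auto simp: algebra_simps)
  thus ?thesis by simp
qed

text \<open>With r = \<open>norm x + y\<close> one has (r/2)^2 \<le> |x|^2 + y^2 \<le> r^2. The
  exponent -(n+1)/2 turns both squares into inverse integer powers of r, at a loss of
  2^(n+1).\<close>

lemma poisson_profile_bounds:
  fixes x :: "'a::euclidean_space"
  assumes "y > 0"
  shows "poisson_cmp x y \<le> poisson_profile x y" "poisson_profile x y \<le> 2 ^ (DIM('a) + 1) * poisson_cmp x y"
proof -
  let ?N = "DIM('a) + 1" and ?r = "norm x + y"
  have r: "?r > 0" using assms by (intro add_nonneg_pos) auto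
  have s: "(norm x)\<^sup>2 + y\<^sup>2 > 0" using assms by (intro add_nonneg_pos) auto
  have e: "(c * ?r)\<^sup>2 powr (- (real DIM('a) + 1) / 2) = 1 / (c * ?r) ^ ?N" if "c > 0" for c
  proof -
    have p: "c * ?r > 0" using that r by simp
    have "(c * ?r)\<^sup>2 = (c * ?r) powr 2" using p by (simp add: powr_numeral)
    hence "(c * ?r)\<^sup>2 powr (- (real DIM('a) + 1) / 2) = (c * ?r) powr (2 * (- (real DIM('a) + 1) / 2))"
      by (simp only: powr_powr)
    also have "\<dots> = (c * ?r) powr (- real ?N)"
      by (rule arg_cong[where f = "(powr) (c * ?r)"]) simp
    also have "\<dots> = 1 / (c * ?r) ^ ?N"
      unfolding powr_minus powr_realpow[OF p] by (simp only: divide_inverse mult_1)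
    finally show ?thesis .
  qed
  have "?r\<^sup>2 powr (- (real DIM('a) + 1) / 2) \<le> ((norm x)\<^sup>2 + y\<^sup>2) powr (- (real DIM('a) + 1) / 2)"
    using assms s by (intro powr_mono2') (auto simp: power2_sum)
  hence "1 / ?r ^ ?N \<le> ((norm x)\<^sup>2 + y\<^sup>2) powr (- (real DIM('a) + 1) / 2)"
    by (simp only: e[of 1, simplified mult_1, OF zero_less_one])
  from mult_left_mono[OF this, of y] show "poisson_cmp x y \<le> poisson_profile x y"
    unfolding poisson_cmp_def poisson_profile_def using assms by simp
  have "(1/2 * ?r)\<^sup>2 \<le> (norm x)\<^sup>2 + y\<^sup>2"
  proof -
    have "(norm x)\<^sup>2 + y\<^sup>2 - (1/2 * ?r)\<^sup>2 = ((norm x - y)\<^sup>2 + 2 * (norm x)\<^sup>2 + 2 * y\<^sup>2) / 4"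
      by (simp add: power2_eq_square algebra_simps)
    also have "\<dots> \<ge> 0" by simp
    finally show ?thesis by simp
  qed
  hence "((norm x)\<^sup>2 + y\<^sup>2) powr (- (real DIM('a) + 1) / 2) \<le> (1/2 * ?r)\<^sup>2 powr (- (real DIM('a) + 1) / 2)"
    using r by (intro powr_mono2') (auto intro!: zero_less_power)
  also have "\<dots> = 1 / (1/2 * ?r) ^ ?N" by (rule e) simp
  also have "\<dots> = 2 ^ ?N / ?r ^ ?N"
    by (simp only: power_mult_distrib power_one_over) (simp add: field_simps)
  finally have "((norm x)\<^sup>2 + y\<^sup>2) powr (- (real DIM('a) + 1) / 2) \<le> 2 ^ ?N / ?r ^ ?N" .
  from mult_left_mono[OF this, of y] show "poisson_profile x y \<le> 2 ^ ?N * poisson_cmp x y"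
    unfolding poisson_cmp_def poisson_profile_def using assms by (simp add: mult_ac del: power_Suc)
qed

lemma poisson_kernel_bounds:
  fixes x :: "'a::euclidean_space"
  assumes "y > 0"
  shows "poisson_const TYPE('a) * poisson_cmp x y \<le> poisson_kernel x y"
    "poisson_kernel x y \<le> poisson_const TYPE('a) * 2 ^ (DIM('a) + 1) * poisson_cmp x y"
  using poisson_profile_bounds[OF assms, of x] poisson_const_pos[where 'a='a]
  by (auto simp: poisson_kernel_def mult.assoc simp del: power_Suc)

lemma poisson_kernel_pos: "y > 0 \<Longrightarrow> poisson_kernel (x::'a::euclidean_space) y > 0"
  using poisson_kernel_bounds(1)[of y x] poisson_cmp_pos[of y x] poisson_const_pos[where 'a='a]
  by (meson less_le_trans mult_pos_pos)

section \<open>Measurability and normalisation of the kernel\<close>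

lemma poisson_kernel_measurable:
  "(\<lambda>p. poisson_kernel (fst p :: 'a::euclidean_space) (snd p)) \<in> borel_measurable borel"
proof -
  have [measurable]: "(fst :: 'a \<times> real \<Rightarrow> 'a) \<in> borel_measurable borel"
    "(snd :: 'a \<times> real \<Rightarrow> real) \<in> borel_measurable borel"
    by (intro borel_measurable_continuous_onI continuous_intros)+
  show ?thesis unfolding poisson_kernel_def poisson_profile_def by measurable
qed

lemma poisson_cmp_measurable:
  "(\<lambda>p. poisson_cmp (fst p :: 'a::euclidean_space) (snd p)) \<in> borel_measurable borel"
proof -
  have [measurable]: "(fst :: 'a \<times> real \<Rightarrow> 'a) \<in> borel_measurable borel"
    "(snd :: 'a \<times> real \<Rightarrow> real) \<in> borel_measurable borel"
    by (intro borel_measurable_continuous_onI continuous_intros)+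
  show ?thesis unfolding poisson_cmp_def by measurable
qed

lemma measurable_compose_pair:
  assumes "(\<lambda>p. F (fst p) (snd p)) \<in> borel_measurable borel"
    and [measurable]: "f \<in> borel_measurable M" "g \<in> borel_measurable M"
  shows "(\<lambda>w. F (f w :: 'a::euclidean_space) (g w :: real) :: real) \<in> borel_measurable M"
proof -
  have "(\<lambda>w. (f w, g w)) \<in> borel_measurable M" by measurable
  from measurable_compose[OF this assms(1)] show ?thesis by simp
qed

lemmas poisson_kernel_measurable' [measurable (raw)] = measurable_compose_pair[OF poisson_kernel_measurable]
lemmas poisson_cmp_measurable' [measurable (raw)] = measurable_compose_pair[OF poisson_cmp_measurable]

lemma nn_integral_poisson_kernel:
  assumes "y > 0"
  shows "(\<integral>\<^sup>+ t. ennreal (poisson_kernel (x - t :: 'a::euclidean_space) y) \<partial>lborel) = 1"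
proof -
  \<comment> \<open>A non-integrable function has integral 0 by convention, so the value 1 forces
    integrability.\<close>
  have "integrable lborel (\<lambda>t::'a. poisson_kernel t y)"
    using integral_poisson_kernel[OF assms, where 'a='a] not_integrable_integral_eq by fastforce
  hence *: "(\<integral>\<^sup>+ t. ennreal (poisson_kernel (t :: 'a) y) \<partial>lborel) = 1"
    using assms by (subst nn_integral_eq_integral)
      (auto simp: integral_poisson_kernel less_imp_le poisson_kernel_pos)
  have "poisson_kernel (x - t) y = poisson_kernel (- x + t) y" for t :: 'a
    by (simp add: poisson_kernel_def poisson_profile_def norm_minus_commute)
  hence "(\<integral>\<^sup>+ t. ennreal (poisson_kernel (x - t :: 'a) y) \<partial>lborel)
      = (\<integral>\<^sup>+ t. ennreal (poisson_kernel (- x + t :: 'a) y) \<partial>lborel)" by simp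
  also have "\<dots> = (\<integral>\<^sup>+ t. ennreal (poisson_kernel (t :: 'a) y) \<partial>distr lborel borel ((+) (- x)))"
    by (subst nn_integral_distr) auto
  also have "\<dots> = 1" unfolding lborel_distr_plus by (rule *)
  finally show ?thesis .
qed

text \<open>By the semigroup law this is the Poisson kernel of \<open>fst z - fst w\<close> at
  height \<open>snd z + snd w\<close>; the two-sided bounds by \<open>pp_cmp\<close> below stand in
  for that law.\<close>

definition pp_kernel :: "'a::euclidean_space \<times> real \<Rightarrow> 'a \<times> real \<Rightarrow> ennreal" where
  "pp_kernel z w = (\<integral>\<^sup>+ t. ennreal (poisson_kernel (fst z - t) (snd z)) *
      ennreal (poisson_kernel (fst w - t) (snd w)) \<partial>lborel)"

lemma pp_kernel_sym: "pp_kernel z w = pp_kernel w z"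
  by (simp add: pp_kernel_def mult.commute)

text \<open>For every boundary point t one of the two factors is at most a multiple B of
  \<open>pp_cmp z w\<close>: the factor of the upper point if the horizontal distance D is at most
  its height or at most 2|x - t|, and otherwise that of the lower point, since then t is farther
  than D/2 from u. So the product is at most B times the sum of the factors, and each factor has
  integral 1.\<close>

lemma pp_kernel_le:
  fixes z w :: "'a::euclidean_space \<times> real"
  assumes "snd w > 0" "snd w \<le> snd z"
  shows "pp_kernel z w \<le> ennreal (poisson_const TYPE('a) * 2 ^ (DIM('a) + 1) * (2 * 5 ^ (DIM('a) + 1)) * pp_cmp z w) * 2"
proof -
  define x y u v where "x = fst z" "y = snd z" "u = fst w" "v = snd w"
  note xyuv = this
  let ?N = "DIM('a) + 1" and ?D = "norm (x - u)"
  define B where "B = poisson_const TYPE('a) * 2 ^ ?N * (2 * 5 ^ ?N) * pp_cmp z w"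
  have y: "y > 0" and v: "v > 0" "v \<le> y" using assms by (auto simp: xyuv)
  have h: "pp_cmp z w = poisson_cmp (x - u) (y + v)" by (simp add: pp_cmp_def xyuv)
  have pk: "poisson_kernel s r \<le> B" if "r > 0" "poisson_cmp s r \<le> 2 * 5 ^ ?N * pp_cmp z w" for s :: 'a and r
  proof -
    have "poisson_kernel s r \<le> poisson_const TYPE('a) * 2 ^ ?N * poisson_cmp s r"
      using poisson_kernel_bounds(2)[OF that(1)] .
    also have "\<dots> \<le> B" unfolding B_def using that(2) poisson_const_pos[where 'a='a]
      by (simp add: mult.assoc del: power_Suc)
    finally show ?thesis .
  qed
  have B0: "B \<ge> 0"
    unfolding B_def using pp_cmp_pos[of z w] poisson_const_pos[where 'a='a] assms by simp
  have pt: "ennreal (poisson_kernel (x - t) y) * ennreal (poisson_kernel (u - t) v)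
      \<le> ennreal B * (ennreal (poisson_kernel (x - t) y) + ennreal (poisson_kernel (u - t) v))" for t
  proof -
    have tri: "?D \<le> norm (x - t) + norm (u - t)"
      using norm_triangle_ineq4[of "x - t" "u - t"] by simp
    have "poisson_kernel (x - t) y \<le> B \<or> poisson_kernel (u - t) v \<le> B"
    proof (cases "?D \<le> y \<or> ?D \<le> 2 * norm (x - t)")
      case True
      have "poisson_cmp (x - t) y \<le> 1 * 5 ^ ?N * poisson_cmp (x - u) (y + v)"
        using True y v norm_ge_zero[of "x - t"] by (intro poisson_cmp_le_poisson_cmp) (auto simp del: norm_ge_zero)
      also have "\<dots> \<le> 2 * 5 ^ ?N * poisson_cmp (x - u) (y + v)"
        using poisson_cmp_pos[of "y + v" "x - u"] y v by (intro mult_right_mono) auto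
      finally show ?thesis using pk[OF y] h by auto
    next
      case False
      have "poisson_cmp (u - t) v \<le> 1 * 5 ^ ?N * poisson_cmp (x - u) (y + v)"
        using False y v tri by (intro poisson_cmp_le_poisson_cmp) auto
      also have "\<dots> \<le> 2 * 5 ^ ?N * poisson_cmp (x - u) (y + v)"
        using poisson_cmp_pos[of "y + v" "x - u"] y v by (intro mult_right_mono) auto
      finally show ?thesis using pk[OF v(1)] h by auto
    qed
    thus ?thesis
    proof
      assume "poisson_kernel (x - t) y \<le> B"
      hence "ennreal (poisson_kernel (x - t) y) * ennreal (poisson_kernel (u - t) v)
          \<le> ennreal B * ennreal (poisson_kernel (u - t) v)" by (intro mult_right_mono ennreal_leI) auto
      thus ?thesis by (simp add: distrib_left add_increasing)
    next
      assume "poisson_kernel (u - t) v \<le> B"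
      hence "ennreal (poisson_kernel (u - t) v) * ennreal (poisson_kernel (x - t) y)
          \<le> ennreal B * ennreal (poisson_kernel (x - t) y)" by (intro mult_right_mono ennreal_leI) auto
      thus ?thesis by (simp add: distrib_left add_increasing2 mult.commute)
    qed
  qed
  have "pp_kernel z w \<le> (\<integral>\<^sup>+ t. ennreal B * (ennreal (poisson_kernel (x - t) y) + ennreal (poisson_kernel (u - t) v)) \<partial>lborel)"
    unfolding pp_kernel_def xyuv[symmetric] by (intro nn_integral_mono pt)
  also have "\<dots> = ennreal B * 2"
    using y v by (subst nn_integral_cmult, measurable, subst nn_integral_add)
      (auto simp: nn_integral_poisson_kernel one_add_one)
  finally show ?thesis unfolding B_def .
qed

text \<open>It is enough to integrate over the ball about u whose radius is the smaller height v.
  There the lower factor is of order \<open>1 / v^n\<close>, which cancels the volume of the ball,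
  and the upper factor is at least of order \<open>pp_cmp z w\<close>.\<close>

lemma pp_kernel_ge:
  fixes z w :: "'a::euclidean_space \<times> real"
  assumes "snd w > 0" "snd w \<le> snd z"
  shows "ennreal ((poisson_const TYPE('a))\<^sup>2 * unit_ball_vol (real DIM('a)) / (2 * 2 ^ (DIM('a) + 1)) * pp_cmp z w) \<le> pp_kernel z w"
proof -
  define x y u v where "x = fst z" "y = snd z" "u = fst w" "v = snd w"
  note xyuv = this
  let ?N = "DIM('a) + 1" and ?c = "poisson_const TYPE('a)"
  have y: "y > 0" and v: "v > 0" "v \<le> y" using assms by (auto simp: xyuv)
  have h: "pp_cmp z w = poisson_cmp (x - u) (y + v)" by (simp add: pp_cmp_def xyuv)
  have c: "?c > 0" by (rule poisson_const_pos)
  have h0: "pp_cmp z w > 0" using assms by (intro pp_cmp_pos) auto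
  define B where "B = (?c * (pp_cmp z w / 2)) * (?c * (1 / (2 ^ ?N * v ^ DIM('a))))"
  have pt: "ennreal B * indicator (cball u v) t \<le>
      ennreal (poisson_kernel (x - t) y) * ennreal (poisson_kernel (u - t) v)" for t
  proof (cases "t \<in> cball u v")
    case True
    hence n: "norm (u - t) \<le> v" by (simp add: dist_norm)
    have "norm (x - t) \<le> norm (x - u) + norm (u - t)" using norm_triangle_ineq[of "x - u" "u - t"] by simp
    hence "poisson_cmp (x - u) (y + v) \<le> 2 * 1 ^ ?N * poisson_cmp (x - t) y"
      using y v n by (intro poisson_cmp_le_poisson_cmp) auto
    hence 1: "pp_cmp z w / 2 \<le> poisson_cmp (x - t) y" by (simp add: h)
    have "1 / (2 ^ ?N * v ^ DIM('a)) = v / (2 * v) ^ ?N" using v by (simp add: field_simps power_mult_distrib)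
    also have "\<dots> \<le> poisson_cmp (u - t) v" unfolding poisson_cmp_def using n v
      by (intro divide_left_mono power_mono mult_pos_pos zero_less_power add_nonneg_pos) auto
    finally have 2: "1 / (2 ^ ?N * v ^ DIM('a)) \<le> poisson_cmp (u - t) v" .
    have "B \<le> poisson_kernel (x - t) y * poisson_kernel (u - t) v"
      unfolding B_def
    proof (intro mult_mono)
      show "?c * (pp_cmp z w / 2) \<le> poisson_kernel (x - t) y"
        using order_trans[OF mult_left_mono[OF 1, of ?c] poisson_kernel_bounds(1)[OF y]] c by simp
      show "?c * (1 / (2 ^ ?N * v ^ DIM('a))) \<le> poisson_kernel (u - t) v"
        using order_trans[OF mult_left_mono[OF 2, of ?c] poisson_kernel_bounds(1)[OF v(1)]] c by simp
    qed (use c v y in \<open>auto simp: less_imp_le poisson_kernel_pos\<close>)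
    thus ?thesis using True y v by (simp add: ennreal_mult[symmetric] less_imp_le poisson_kernel_pos ennreal_leI)
  qed simp
  have V: "unit_ball_vol (real DIM('a)) \<ge> 0" by simp
  have "ennreal (?c\<^sup>2 * unit_ball_vol (real DIM('a)) / (2 * 2 ^ ?N) * pp_cmp z w) = ennreal B * ennreal (unit_ball_vol (real DIM('a)) * v ^ DIM('a))"
  proof -
    have "?c\<^sup>2 * V / (2 * P) * h = (?c * (h / 2)) * (?c * (1 / (P * r))) * (V * r)" if "r > 0" "P > 0" for V P h r :: real
      using that by (simp add: power2_eq_square field_simps)
    from this[of "v ^ DIM('a)" "2 ^ ?N"]
    have "?c\<^sup>2 * unit_ball_vol (real DIM('a)) / (2 * 2 ^ ?N) * pp_cmp z w = B * (unit_ball_vol (real DIM('a)) * v ^ DIM('a))"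
      unfolding B_def using v by simp
    moreover have "B \<ge> 0" unfolding B_def using c h0 v by (intro mult_nonneg_nonneg) auto
    ultimately show ?thesis using V v by (simp only: ennreal_mult mult_nonneg_nonneg zero_le_power less_imp_le)
  qed
  also have "\<dots> = (\<integral>\<^sup>+ t. ennreal B * indicator (cball u v) t \<partial>lborel)"
    using v by (subst nn_integral_cmult_indicator) (simp_all add: emeasure_cball)
  also have "\<dots> \<le> pp_kernel z w"
    unfolding pp_kernel_def xyuv[symmetric] by (intro nn_integral_mono pt)
  finally show ?thesis .
qed

lemma pp_kernel_bounds:
  "\<exists>c>0. \<exists>C>0. \<forall>z w :: 'a::euclidean_space \<times> real. snd z > 0 \<longrightarrow> snd w > 0 \<longrightarrow>
     ennreal c * ennreal (pp_cmp z w) \<le> pp_kernel z w \<and> pp_kernel z w \<le> ennreal C * ennreal (pp_cmp z w)"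
proof -
  define c where "c = (poisson_const TYPE('a))\<^sup>2 * unit_ball_vol (real DIM('a)) / (2 * 2 ^ (DIM('a) + 1))"
  define C where "C = poisson_const TYPE('a) * 2 ^ (DIM('a) + 1) * (2 * 5 ^ (DIM('a) + 1)) * 2"
  have p: "c > 0" "C > 0"
    using poisson_const_pos[where 'a='a] unit_ball_vol_pos[of "real DIM('a)"] by (auto simp: c_def C_def)
  have *: "ennreal c * ennreal (pp_cmp z w) \<le> pp_kernel z w \<and> pp_kernel z w \<le> ennreal C * ennreal (pp_cmp z w)"
    if "snd w > 0" "snd w \<le> snd z" for z w :: "'a \<times> real"
  proof -
    have h: "pp_cmp z w > 0" using that by (intro pp_cmp_pos) auto
    have "ennreal C * ennreal (pp_cmp z w) = ennreal (C / 2 * pp_cmp z w * 2)"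
      using p h by (simp add: ennreal_mult[symmetric])
    also have "\<dots> = ennreal (C / 2 * pp_cmp z w) * 2"
      using p h by (subst ennreal_mult) auto
    finally have "ennreal C * ennreal (pp_cmp z w)
        = ennreal (poisson_const TYPE('a) * 2 ^ (DIM('a) + 1) * (2 * 5 ^ (DIM('a) + 1)) * pp_cmp z w) * 2"
      by (simp add: C_def)
    thus ?thesis
      using pp_kernel_le[OF that] pp_kernel_ge[OF that] p h
      by (simp add: ennreal_mult[symmetric] c_def del: power_Suc)
  qed
  have "ennreal c * ennreal (pp_cmp z w) \<le> pp_kernel z w \<and> pp_kernel z w \<le> ennreal C * ennreal (pp_cmp z w)"
    if "snd z > 0" "snd w > 0" for z w :: "'a \<times> real"
    using *[of w z] *[of z w] that
    by (cases "snd w \<le> snd z") (auto simp: pp_kernel_sym[of z w] pp_cmp_sym[of z w])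
  thus ?thesis using p by blast
qed

section \<open>Potentials and the weak maximum principle\<close>

lemma nn_integral_poisson_cmp_le:
  assumes "y > 0"
  shows "(\<integral>\<^sup>+ t. ennreal (poisson_cmp (x - t :: 'a::euclidean_space) y) \<partial>lborel) \<le> ennreal (1 / poisson_const TYPE('a))"
proof -
  have c: "poisson_const TYPE('a) > 0" by (rule poisson_const_pos)
  have "poisson_cmp (x - t) y \<le> 1 / poisson_const TYPE('a) * poisson_kernel (x - t) y" for t :: 'a
    using poisson_kernel_bounds(1)[OF assms, of "x - t"] c by (simp add: field_simps)
  hence "(\<integral>\<^sup>+ t. ennreal (poisson_cmp (x - t :: 'a) y) \<partial>lborel)
      \<le> (\<integral>\<^sup>+ t. ennreal (1 / poisson_const TYPE('a)) * ennreal (poisson_kernel (x - t :: 'a) y) \<partial>lborel)"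
    using c assms by (intro nn_integral_mono)
      (simp add: ennreal_mult[symmetric] less_imp_le poisson_kernel_pos ennreal_leI)
  also have "\<dots> = ennreal (1 / poisson_const TYPE('a))"
    using assms by (subst nn_integral_cmult) (auto simp: nn_integral_poisson_kernel)
  finally show ?thesis .
qed

text \<open>Dually, \<open>w \<in> cone t\<close> says that t lies in the boundary ball with centre
  \<open>fst w\<close> and radius \<open>snd w\<close>; this turns integrals over such balls into
  integrals over cones.\<close>

definition cone :: "'a::euclidean_space \<Rightarrow> ('a \<times> real) set" where
  "cone t = {w. norm (fst w - t) \<le> snd w}"

text \<open>The 2 is the loss in replacing the height sum by the larger height, the ball volume
  normalises an average, and \<open>1 / poisson_const\<close> bounds the integral of
  \<open>poisson_cmp\<close>.\<close>

definition cone_const :: "'a::euclidean_space itself \<Rightarrow> real" where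
  "cone_const _ = 2 / (unit_ball_vol (real DIM('a)) * poisson_const TYPE('a))"

lemma cone_const_pos: "cone_const TYPE('a::euclidean_space) > 0"
  unfolding cone_const_def using unit_ball_vol_pos[of "real DIM('a)"] poisson_const_pos[where 'a='a] by simp

text \<open>General enough to contain the locally finite measures on the half-space, their
  restrictions written as densities, and point measures with finitely many atoms.\<close>

locale halfspace_measure = sigma_finite_measure M
  for M :: "('a::euclidean_space \<times> real) measure" +
  assumes fst_measurable [measurable]: "fst \<in> borel_measurable M"
    and snd_measurable [measurable]: "snd \<in> borel_measurable M"
    and snd_pos: "w \<in> space M \<Longrightarrow> snd w > 0"
begin

text \<open>Up to the factor \<open>unit_ball_vol\<close>, the boundary density obtained by
  spreading the mass at each w evenly over the ball with centre \<open>fst w\<close> and radius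
  \<open>snd w\<close>.\<close>

definition cone_mass :: "'a \<Rightarrow> ennreal" where
  "cone_mass t = (\<integral>\<^sup>+ w. indicator (cone t) w * ennreal (1 / snd w ^ DIM('a)) \<partial>M)"

definition potential :: "'a \<times> real \<Rightarrow> ennreal" where
  "potential z = (\<integral>\<^sup>+ w. ennreal (pp_cmp z w) \<partial>M)"

lemma pp_cmp_measurable [measurable]: "pp_cmp z \<in> borel_measurable M"
  unfolding pp_cmp_def by measurable

text \<open>If w is no higher than \<open>z\<close> and t lies in the boundary ball of w, then
  \<open>pp_cmp z w\<close> is at most twice \<open>poisson_cmp (fst z - t) (snd z)\<close>.
  Averaging over the ball and exchanging integrals leaves \<open>cone_mass\<close> under an integral
  against \<open>poisson_cmp\<close>, whose total mass is bounded.\<close>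

lemma low_potential_bound:
  assumes "\<And>t. cone_mass t \<le> m" "snd z > 0"
  shows "(\<integral>\<^sup>+ w. indicator {w. snd w \<le> snd z} w * ennreal (pp_cmp z w) \<partial>M) \<le> ennreal (cone_const TYPE('a)) * m"
proof -
  let ?x = "fst z" and ?y = "snd z" and ?V = "unit_ball_vol (real DIM('a))"
  have V: "?V > 0" "?V \<noteq> 0" using unit_ball_vol_pos[of "real DIM('a)"] by linarith+
  have le: "indicator {w. snd w \<le> ?y} w * ennreal (pp_cmp z w) \<le>
      (\<integral>\<^sup>+ t. ennreal (2 / ?V) * (ennreal (poisson_cmp (?x - t) ?y) * (indicator (cone t) w * ennreal (1 / snd w ^ DIM('a)))) \<partial>lborel)"
    (is "_ \<le> ?R") if w: "w \<in> space M" for w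
  proof (cases "snd w \<le> ?y")
    case True
    define v where "v = snd w"
    have v: "v > 0" "v \<le> ?y" using True snd_pos[OF w] by (auto simp: v_def)
    have "ennreal (pp_cmp z w / (?V * v ^ DIM('a))) * indicator (cball (fst w) v) t \<le>
        ennreal (2 / ?V) * (ennreal (poisson_cmp (?x - t) ?y) * (indicator (cone t) w * ennreal (1 / snd w ^ DIM('a))))" for t
    proof (cases "t \<in> cball (fst w) v")
      case True
      hence n: "norm (fst w - t) \<le> v" by (simp add: dist_norm)
      have "norm (?x - t) \<le> norm (?x - fst w) + norm (fst w - t)"
        using norm_triangle_ineq[of "?x - fst w" "fst w - t"] by simp
      hence "poisson_cmp (?x - fst w) (?y + v) \<le> 2 * 1 ^ (DIM('a) + 1) * poisson_cmp (?x - t) ?y"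
        using v n by (intro poisson_cmp_le_poisson_cmp) auto
      hence "pp_cmp z w \<le> 2 * poisson_cmp (?x - t) ?y" by (simp add: pp_cmp_def v_def)
      from divide_right_mono[OF this, of "?V * v ^ DIM('a)"]
      have "pp_cmp z w / (?V * v ^ DIM('a)) \<le> 2 / ?V * (poisson_cmp (?x - t) ?y * (1 / v ^ DIM('a)))"
        using v V by simp
      thus ?thesis using True n v V poisson_cmp_pos[of ?y "?x - t"] assms(2)
        by (simp add: cone_def v_def[symmetric] ennreal_mult[symmetric] ennreal_leI)
    qed simp
    hence "(\<integral>\<^sup>+ t. ennreal (pp_cmp z w / (?V * v ^ DIM('a))) * indicator (cball (fst w) v) t \<partial>lborel) \<le> ?R"
      by (intro nn_integral_mono)
    also have "(\<integral>\<^sup>+ t. ennreal (pp_cmp z w / (?V * v ^ DIM('a))) * indicator (cball (fst w) v) t \<partial>lborel)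
        = ennreal (pp_cmp z w / (?V * v ^ DIM('a))) * ennreal (?V * v ^ DIM('a))"
      using v by (subst nn_integral_cmult_indicator) (simp_all add: emeasure_cball)
    also have "\<dots> = ennreal (pp_cmp z w)"
      using v V pp_cmp_pos[of z w] assms(2) by (subst ennreal_mult[symmetric]) (auto simp: v_def)
    finally show ?thesis using True by simp
  qed simp
  have [measurable]: "(\<lambda>(w, t). indicator (cone t) w :: ennreal) \<in> borel_measurable (M \<Otimes>\<^sub>M lborel)"
  proof -
    have "(\<lambda>p. indicator {p \<in> space (M \<Otimes>\<^sub>M lborel). norm (fst (fst p) - snd p) \<le> snd (fst p)} p :: ennreal)
       \<in> borel_measurable (M \<Otimes>\<^sub>M lborel)" by measurable
    thus ?thesis
      by (rule measurable_cong[THEN iffD1, rotated]) (auto simp: cone_def indicator_def split: prod.splits)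
  qed
  have "(\<integral>\<^sup>+ w. indicator {w. snd w \<le> ?y} w * ennreal (pp_cmp z w) \<partial>M) \<le>
     (\<integral>\<^sup>+ w. (\<integral>\<^sup>+ t. ennreal (2 / ?V) * (ennreal (poisson_cmp (?x - t) ?y) * (indicator (cone t) w * ennreal (1 / snd w ^ DIM('a)))) \<partial>lborel) \<partial>M)"
    by (intro nn_integral_mono le)
  also have "\<dots> = (\<integral>\<^sup>+ t. (\<integral>\<^sup>+ w. ennreal (2 / ?V) * (ennreal (poisson_cmp (?x - t) ?y) * (indicator (cone t) w * ennreal (1 / snd w ^ DIM('a)))) \<partial>M) \<partial>lborel)"
  proof -
    interpret pair_sigma_finite M "lborel :: 'a measure" by unfold_locales
    show ?thesis by (rule Fubini'[symmetric]) measurable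
  qed
  also have "\<dots> = (\<integral>\<^sup>+ t. ennreal (2 / ?V) * (ennreal (poisson_cmp (?x - t) ?y) * cone_mass t) \<partial>lborel)"
    unfolding cone_mass_def by (simp add: nn_integral_cmult)
  also have "\<dots> \<le> (\<integral>\<^sup>+ t. ennreal (2 / ?V) * m * ennreal (poisson_cmp (?x - t) ?y) \<partial>lborel)"
    using assms(1) by (intro nn_integral_mono) (auto simp: mult_ac intro: mult_right_mono)
  also have "\<dots> \<le> ennreal (2 / ?V) * m * ennreal (1 / poisson_const TYPE('a))"
    using assms(2) by (subst nn_integral_cmult) (auto intro!: mult_left_mono nn_integral_poisson_cmp_le)
  also have "\<dots> = ennreal (cone_const TYPE('a)) * m"
    using V poisson_const_pos[where 'a='a]
    by (simp add: cone_const_def mult_ac) (simp add: ennreal_mult[symmetric] mult.assoc[symmetric] mult_ac)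
  finally show ?thesis .
qed

lemma potential_split:
  "potential z = (\<integral>\<^sup>+ w. indicator {w. snd w \<le> y} w * ennreal (pp_cmp z w) \<partial>M)
      + (\<integral>\<^sup>+ w. indicator {w. snd w > y} w * ennreal (pp_cmp z w) \<partial>M)"
  unfolding potential_def
  by (subst nn_integral_add[symmetric], measurable)
    (auto intro!: nn_integral_cong simp: indicator_def)

text \<open>The mass above z is seen from an almost nearest carrier point \<open>w'\<close> above z,
  at the cost of \<open>3 ^ (DIM('a) + 1)\<close>, and the potential at \<open>w'\<close> is split
  once more. The hypothesis \<open>high\<close> concerns only points of S and only mass strictly
  above them, the form that \<open>greedy_weights\<close> delivers.\<close>

lemma potential_bound:
  assumes S: "AE w in M. w \<in> S" "\<And>w. w \<in> S \<Longrightarrow> snd w > 0"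
    and cone: "\<And>t. cone_mass t \<le> m"
    and high: "\<And>z. z \<in> S \<Longrightarrow> (\<integral>\<^sup>+ w. indicator {w. snd w > snd z} w * ennreal (pp_cmp z w) \<partial>M) \<le> m"
    and z: "snd z > 0"
  shows "potential z \<le> ennreal (cone_const TYPE('a) + 3 ^ (DIM('a) + 1) * (cone_const TYPE('a) + 1)) * m"
proof -
  let ?L = "cone_const TYPE('a)" and ?N = "DIM('a) + 1"
  have L: "?L > 0" by (rule cone_const_pos)
  define T where "T = {w \<in> S. snd w > snd z}"
  have "(\<integral>\<^sup>+ w. indicator {w. snd w > snd z} w * ennreal (pp_cmp z w) \<partial>M) \<le> ennreal (3 ^ ?N) * (ennreal (?L + 1) * m)"
  proof (cases "T = {}")
    case True
    have "AE w in M. indicator {w. snd w > snd z} w * ennreal (pp_cmp z w) = 0"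
      using S(1) by eventually_elim (use True in \<open>auto simp: T_def indicator_def\<close>)
    hence "(\<integral>\<^sup>+ w. indicator {w. snd w > snd z} w * ennreal (pp_cmp z w) \<partial>M) = (\<integral>\<^sup>+ w. 0 \<partial>M)"
      by (rule nn_integral_cong_AE)
    thus ?thesis by simp
  next
    case False
    define d where "d w = norm (fst z - fst w) + snd w" for w
    have d: "d w > snd z" if "w \<in> T" for w
      using that unfolding d_def T_def by (auto intro: add_nonneg_pos less_le_trans)
    have bdd: "bdd_below (d ` T)" using d by (intro bdd_belowI2[of _ "snd z"]) (auto intro: less_imp_le)
    have "Inf (d ` T) \<ge> snd z" using False d by (intro cINF_greatest) (auto intro: less_imp_le)
    \<comment> \<open>S is an arbitrary carrier, so the infimum need not be attained; since it is
      positive, a point within a factor 2 of it exists.\<close>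
    hence "Inf (d ` T) < 2 * Inf (d ` T)" using z by simp
    from cInf_lessD[OF _ this] obtain w' where w': "w' \<in> T" "d w' < 2 * Inf (d ` T)"
      using False by blast
    have d2: "d w' \<le> 2 * d w" if "w \<in> T" for w
      using w'(2) cINF_lower[OF bdd that] by simp
    have w'S: "w' \<in> S" "snd w' > snd z" "snd w' > 0" using w' z by (auto simp: T_def)
    have "(\<integral>\<^sup>+ w. indicator {w. snd w > snd z} w * ennreal (pp_cmp z w) \<partial>M) \<le> (\<integral>\<^sup>+ w. ennreal (3 ^ ?N) * ennreal (pp_cmp w' w) \<partial>M)"
    proof (intro nn_integral_mono_AE, use S(1) in eventually_elim)
      fix w assume w: "w \<in> S"
      show "indicator {w. snd w > snd z} w * ennreal (pp_cmp z w) \<le> ennreal (3 ^ ?N) * ennreal (pp_cmp w' w)"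
      proof (cases "snd w > snd z")
        case True
        hence "w \<in> T" using w by (simp add: T_def)
        from d2[OF this] have "pp_cmp z w \<le> (2 + 1) ^ ?N * pp_cmp w' w"
          using w'S True z S(2)[OF w] by (intro pp_cmp_triangle) (auto simp: d_def)
        thus ?thesis using True pp_cmp_pos[of w' w] w'S S(2)[OF w]
          by (simp add: ennreal_mult[symmetric] ennreal_leI del: power_Suc)
      qed simp
    qed
    also have "\<dots> = ennreal (3 ^ ?N) * potential w'"
      unfolding potential_def by (rule nn_integral_cmult) measurable
    also have "potential w' \<le> ennreal ?L * m + m"
      unfolding potential_split[of w' "snd w'"]
      by (intro add_mono low_potential_bound cone high w'S)
    also have "\<dots> = ennreal (?L + 1) * m"
      using L by (simp add: ennreal_plus distrib_right del: ennreal_plus[symmetric])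
    finally show ?thesis by (simp add: mult_left_mono del: power_Suc)
  qed
  hence "potential z \<le> ennreal ?L * m + ennreal (3 ^ ?N) * (ennreal (?L + 1) * m)"
    unfolding potential_split[of z "snd z"] by (intro add_mono low_potential_bound cone z)
  also have "\<dots> = ennreal (?L + 3 ^ ?N * (?L + 1)) * m"
    using L by (subst ennreal_plus) (auto simp: ennreal_mult distrib_right mult.assoc simp del: power_Suc)
  finally show ?thesis .
qed

end

text \<open>Both projections lie within \<open>snd w\<close> and \<open>snd v\<close> of t, so
  horizontal distance plus heights is at most 2 \<open>snd w\<close> + 2 \<open>snd v\<close>, hence
  at most 6 \<open>snd v\<close>. This is the origin of the powers of 6.\<close>

lemma cone_pp_cmp:
  assumes "w \<in> cone t" "v \<in> cone t" "snd v > 0" "snd w > 0" "snd w \<le> 2 * snd v"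
  shows "1 / snd v ^ DIM('a::euclidean_space) \<le> 6 ^ (DIM('a) + 1) * pp_cmp w (v :: 'a \<times> real)"
proof -
  let ?N = "DIM('a) + 1"
  have "norm (fst w - fst v) \<le> norm (fst w - t) + norm (fst v - t)"
    using norm_triangle_ineq4[of "fst w - t" "fst v - t"] by simp
  hence *: "norm (fst w - fst v) + (snd w + snd v) \<le> 6 * snd v"
    using assms by (simp add: cone_def)
  have "1 / snd v ^ DIM('a) = 6 ^ ?N * (snd v / (6 * snd v) ^ ?N)"
    using assms by (simp add: power_mult_distrib)
  also have "\<dots> \<le> 6 ^ ?N * pp_cmp w v"
    unfolding pp_cmp_def poisson_cmp_def using * assms
    by (intro mult_left_mono frac_le power_mono zero_less_power add_nonneg_pos) auto
  finally show ?thesis .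
qed

text \<open>The bracket is the constant of \<open>potential_bound\<close>; the power of 6 bounds the
  cone masses in terms of the potential on the carrier.\<close>

definition wmp_const :: "'a::euclidean_space itself \<Rightarrow> real" where
  "wmp_const _ = (cone_const TYPE('a) + 3 ^ (DIM('a) + 1) * (cone_const TYPE('a) + 1)) * 6 ^ (DIM('a) + 1)"

lemma wmp_const_pos: "wmp_const TYPE('a::euclidean_space) > 0"
  unfolding wmp_const_def using cone_const_pos[where 'a='a] by (intro mult_pos_pos add_pos_pos) auto

text \<open>What remains for \<open>potential_bound\<close> is the cone mass. For a carrier point
  \<open>w'\<close> at nearly the lowest height in the cone, \<open>cone_pp_cmp\<close> bounds the
  integrand of \<open>cone_mass\<close> by a multiple of \<open>pp_cmp w'\<close>, hence the cone
  mass by the potential at \<open>w'\<close>. Since the carrier may reach down to the vertex, the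
  cone is first cut at height e.\<close>

lemma (in halfspace_measure) weak_maximum_principle:
  assumes S: "AE w in M. w \<in> S" "\<And>w. w \<in> S \<Longrightarrow> snd w > 0"
    and le: "\<And>w. w \<in> S \<Longrightarrow> potential w \<le> m" and z: "snd z > 0"
  shows "potential z \<le> ennreal (wmp_const TYPE('a)) * m"
proof -
  let ?N = "DIM('a) + 1"
  have cm: "cone_mass t \<le> ennreal (6 ^ ?N) * m" for t
  proof -
    let ?f = "\<lambda>w. indicator (cone t) w * ennreal (1 / snd w ^ DIM('a))"
    let ?g = "\<lambda>e w. indicator {w. snd w \<ge> e} w * ?f w"
    have [measurable]: "(\<lambda>w. indicator (cone t) w :: ennreal) \<in> borel_measurable M"
      unfolding cone_def indicator_def mem_Collect_eq by measurable
    have *: "(\<integral>\<^sup>+ w. ?g e w \<partial>M) \<le> ennreal (6 ^ ?N) * m" if e: "e > 0" for e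
    proof (cases "S \<inter> cone t = {}")
      case True
      have "AE w in M. ?g e w = 0"
        using S(1) by eventually_elim (use True in \<open>auto simp: indicator_def\<close>)
      hence "(\<integral>\<^sup>+ w. ?g e w \<partial>M) = (\<integral>\<^sup>+ w. 0 \<partial>M)" by (rule nn_integral_cong_AE)
      thus ?thesis by simp
    next
      case False
      define h where "h = Inf (snd ` (S \<inter> cone t))"
      have bdd: "bdd_below (snd ` (S \<inter> cone t))" using S(2) by (intro bdd_belowI2[of _ 0]) (auto intro: less_imp_le)
      \<comment> \<open>The infimum h of the heights may be 0. Below \<open>2 * max e h\<close>
        there is always a carrier point, and it is at most twice as high as any point of the cut
        cone.\<close>
      have "h < 2 * max e h" using e by (simp add: max_def)
      from cInf_lessD[OF _ this[unfolded h_def]]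
      obtain w' where w': "w' \<in> S" "w' \<in> cone t" "snd w' < 2 * max e h"
        using False unfolding h_def by blast
      have "(\<integral>\<^sup>+ w. ?g e w \<partial>M) \<le> (\<integral>\<^sup>+ w. ennreal (6 ^ ?N) * ennreal (pp_cmp w' w) \<partial>M)"
      proof (intro nn_integral_mono_AE, use S(1) in eventually_elim)
        fix w assume w: "w \<in> S"
        show "?g e w \<le> ennreal (6 ^ ?N) * ennreal (pp_cmp w' w)"
        proof (cases "snd w \<ge> e \<and> w \<in> cone t")
          case True
          have "h \<le> snd w" unfolding h_def using w True by (intro cINF_lower bdd) auto
          hence "snd w' \<le> 2 * snd w" using w'(3) True by (simp add: max_def split: if_splits)
          hence "1 / snd w ^ DIM('a) \<le> 6 ^ ?N * pp_cmp w' w"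
            using True w' S(2)[OF w] S(2)[OF w'(1)] by (intro cone_pp_cmp) auto
          thus ?thesis using True pp_cmp_pos[of w' w] S(2)[OF w] S(2)[OF w'(1)]
            by (simp add: ennreal_mult[symmetric] ennreal_leI del: power_Suc)
        qed auto
      qed
      also have "\<dots> = ennreal (6 ^ ?N) * potential w'"
        unfolding potential_def by (rule nn_integral_cmult) measurable
      also have "\<dots> \<le> ennreal (6 ^ ?N) * m" by (intro mult_left_mono le w'(1)) simp
      finally show ?thesis .
    qed
    have "cone_mass t = (\<integral>\<^sup>+ w. (SUP k. ?g (1 / real (Suc k)) w) \<partial>M)"
      unfolding cone_mass_def
    proof (intro nn_integral_cong antisym)
      fix w assume w: "w \<in> space M"
      obtain k where "inverse (real (Suc k)) < snd w" using reals_Archimedean[OF snd_pos[OF w]] by auto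
      hence "?f w = ?g (1 / real (Suc k)) w" by (simp add: inverse_eq_divide)
      thus "?f w \<le> (SUP k. ?g (1 / real (Suc k)) w)" by (rule order_trans[OF eq_refl SUP_upper[OF UNIV_I]])
      show "(SUP k. ?g (1 / real (Suc k)) w) \<le> ?f w" by (intro SUP_least) (simp add: indicator_def)
    qed
    also have "\<dots> = (SUP k. \<integral>\<^sup>+ w. ?g (1 / real (Suc k)) w \<partial>M)"
    proof (intro nn_integral_monotone_convergence_SUP)
      show "incseq (\<lambda>k. ?g (1 / real (Suc k)))"
      proof (intro incseq_SucI le_funI)
        fix k and w :: "'a \<times> real"
        have "1 / real (Suc (Suc k)) \<le> 1 / real (Suc k)" by (simp add: field_simps)
        thus "?g (1 / real (Suc k)) w \<le> ?g (1 / real (Suc (Suc k))) w"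
          by (intro mult_right_mono) (auto simp: indicator_def)
      qed
    qed measurable
    also have "\<dots> \<le> ennreal (6 ^ ?N) * m" by (intro SUP_least *) simp
    finally show ?thesis .
  qed
  have "(\<integral>\<^sup>+ w. indicator {w. snd w > snd z'} w * ennreal (pp_cmp z' w) \<partial>M) \<le> ennreal (6 ^ ?N) * m" if "z' \<in> S" for z'
  proof -
    have "(\<integral>\<^sup>+ w. indicator {w. snd w > snd z'} w * ennreal (pp_cmp z' w) \<partial>M) \<le> potential z'"
      unfolding potential_def by (intro nn_integral_mono) (simp add: indicator_def)
    also have "\<dots> \<le> 1 * m" using le[OF that] by simp
    also have "\<dots> \<le> ennreal (6 ^ ?N) * m"
      by (intro mult_right_mono) (simp_all del: power_Suc)
    finally show ?thesis .
  qed
  from potential_bound[OF S cm this z] show ?thesis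
    using cone_const_pos[where 'a='a]
    by (simp add: wmp_const_def ennreal_mult mult.assoc del: power_Suc)
qed

section \<open>The operator PP*\<close>

lemma epowr_ennreal [simp]: "x \<ge> 0 \<Longrightarrow> epowr (ennreal x) a = ennreal (x powr a)"
  by (simp add: epowr_def)

lemma epowr_top [simp]: "epowr \<infinity> a = \<infinity>"
  by (simp add: epowr_def)

lemma epowr_0 [simp]: "epowr 0 a = 0"
  by (simp add: epowr_def)

lemma epowr_1 [simp]: "epowr x 1 = x"
  by (cases x) (auto simp: epowr_def)

lemma epowr_lt_top_iff [simp]: "epowr x a < \<infinity> \<longleftrightarrow> x < \<infinity>"
  by (cases x) (auto simp: epowr_def)

lemma epowr_pos_iff [simp]: "0 < epowr x a \<longleftrightarrow> 0 < x"
  by (cases x) (auto simp: epowr_def ennreal_less_zero_iff)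

lemma epowr_mono: "0 < a \<Longrightarrow> x \<le> y \<Longrightarrow> epowr x a \<le> epowr y a"
  by (cases x; cases y) (auto simp: epowr_def top_unique intro!: ennreal_leI powr_mono2)

lemma epowr_epowr: "epowr (epowr x a) b = epowr x (a * b)"
  by (cases x) (auto simp: epowr_def powr_powr)

lemma epowr_cmult: "0 < c \<Longrightarrow> epowr (ennreal c * x) a = ennreal (c powr a) * epowr x a"
  by (cases x) (auto simp: epowr_def powr_mult ennreal_mult[symmetric] ennreal_mult_eq_top_iff ennreal_mult_top)

lemma epowr_measurable [measurable (raw)]:
  assumes [measurable]: "f \<in> borel_measurable M"
  shows "(\<lambda>x. epowr (f x) a) \<in> borel_measurable M"
  unfolding epowr_def by measurable

text \<open>\<open>epowr _ (1 / a)\<close> is a monotone inverse of \<open>epowr _ a\<close>, so the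
  latter is an order isomorphism and preserves suprema.\<close>

lemma epowr_SUP:
  assumes "0 < a"
  shows "epowr (SUP i\<in>I. f i) a = (SUP i\<in>I. epowr (f i) a)"
proof (rule antisym)
  let ?B = "SUP i\<in>I. epowr (f i) a"
  have "f i \<le> epowr ?B (1 / a)" if "i \<in> I" for i
    using epowr_mono[OF _ SUP_upper[OF that, of "\<lambda>i. epowr (f i) a"], of "1 / a"] assms
    by (simp add: epowr_epowr)
  hence "(SUP i\<in>I. f i) \<le> epowr ?B (1 / a)" by (intro SUP_least)
  from epowr_mono[OF assms this] show "epowr (SUP i\<in>I. f i) a \<le> ?B"
    using assms by (simp add: epowr_epowr)
  show "?B \<le> epowr (SUP i\<in>I. f i) a"
    by (intro SUP_least epowr_mono assms SUP_upper)
qed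

text \<open>\<open>PP*\<close> of the measure f dM after the exchange of integrals justified in
  \<open>poisson_poisson_adj_density\<close>; f = 1 gives \<open>PP*\<close> of M itself.\<close>

definition pp_op :: "('a::euclidean_space \<times> real) measure \<Rightarrow> ('a \<times> real \<Rightarrow> ennreal) \<Rightarrow> 'a \<times> real \<Rightarrow> ennreal" where
  "pp_op M f z = (\<integral>\<^sup>+ w. pp_kernel z w * f w \<partial>M)"

lemma pp_op_mono: "(\<And>w. w \<in> space M \<Longrightarrow> f w \<le> g w) \<Longrightarrow> pp_op M f z \<le> pp_op M g z"
  unfolding pp_op_def by (intro nn_integral_mono mult_left_mono) auto

context halfspace_measure
begin

lemma pp_kernel_measurable2: "(\<lambda>p. pp_kernel (fst p) (snd p)) \<in> borel_measurable (M \<Otimes>\<^sub>M M)"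
  unfolding pp_kernel_def by measurable

lemma pp_kernel_measurable [measurable]: "pp_kernel z \<in> borel_measurable M"
  unfolding pp_kernel_def by measurable

lemma pp_op_measurable [measurable (raw)]:
  assumes [measurable]: "f \<in> borel_measurable M"
  shows "pp_op M f \<in> borel_measurable M"
proof -
  note [measurable] = pp_kernel_measurable2
  have "(\<lambda>p. pp_kernel (fst p) (snd p) * f (snd p)) \<in> borel_measurable (M \<Otimes>\<^sub>M M)"
    by measurable
  hence "(\<lambda>(z, w). pp_kernel z w * f w) \<in> borel_measurable (M \<Otimes>\<^sub>M M)"
    by (simp add: case_prod_beta')
  from borel_measurable_nn_integral[OF this] show ?thesis
    unfolding pp_op_def .
qed

lemma pp_op_cmult:
  "f \<in> borel_measurable M \<Longrightarrow> pp_op M (\<lambda>w. c * f w) z = c * pp_op M f z"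
  unfolding pp_op_def by (subst nn_integral_cmult[symmetric]) (auto simp: mult_ac)

lemma poisson_adj_density:
  assumes [measurable]: "f \<in> borel_measurable M"
  shows "poisson_adj (density M f) t = (\<integral>\<^sup>+ w. f w * ennreal (poisson_kernel (fst w - t) (snd w)) \<partial>M)"
  unfolding poisson_adj_def case_prod_beta' by (rule nn_integral_density) measurable

lemma poisson_adj_measurable [measurable]:
  assumes [measurable]: "f \<in> borel_measurable M"
  shows "poisson_adj (density M f) \<in> borel_measurable lborel"
proof -
  have "(\<lambda>(t, w). f w * ennreal (poisson_kernel (fst w - t) (snd w))) \<in> borel_measurable (lborel \<Otimes>\<^sub>M M)"
    by measurable
  from borel_measurable_nn_integral[OF this] show ?thesis
    using poisson_adj_density[OF assms] by (subst measurable_cong) auto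
qed

lemma poisson_poisson_adj_density:
  assumes [measurable]: "f \<in> borel_measurable M"
  shows "poisson_poisson_adj (density M f) = pp_op M f"
proof
  fix z :: "'a \<times> real"
  interpret pair_sigma_finite M "lborel :: 'a measure" by unfold_locales
  let ?P = "\<lambda>z t. ennreal (poisson_kernel (fst z - t) (snd z))"
  have "poisson_poisson_adj (density M f) z = (\<integral>\<^sup>+ t. poisson_adj (density M f) t * ?P z t \<partial>lborel)"
    unfolding poisson_poisson_adj_def poisson_def case_prod_beta' by (rule nn_integral_density) measurable
  also have "\<dots> = (\<integral>\<^sup>+ t. (\<integral>\<^sup>+ w. (?P z t * ?P w t) * f w \<partial>M) \<partial>lborel)"
    unfolding poisson_adj_density[OF assms]
    by (intro nn_integral_cong, subst nn_integral_multc[symmetric]) (auto simp: mult_ac)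
  also have "\<dots> = (\<integral>\<^sup>+ w. (\<integral>\<^sup>+ t. (?P z t * ?P w t) * f w \<partial>lborel) \<partial>M)"
    by (rule Fubini') measurable
  also have "\<dots> = pp_op M f z"
    unfolding pp_op_def pp_kernel_def by (subst nn_integral_multc) auto
  finally show "poisson_poisson_adj (density M f) z = pp_op M f z" .
qed

lemma halfspace_measure_density_indicator:
  assumes "A \<in> sets M"
  shows "halfspace_measure (density M (indicator A))"
proof -
  have "sigma_finite_measure (density M (indicator A))"
    using assms by (subst sigma_finite_iff_density_finite) (auto simp: indicator_def)
  moreover have "halfspace_measure_axioms (density M (indicator A))"
    by unfold_locales (auto simp: snd_pos)
  ultimately show ?thesis by (simp add: halfspace_measure_def)
qed

lemma pp_op_density_indicator:
  assumes [measurable]: "A \<in> sets M" "f \<in> borel_measurable M"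
  shows "pp_op (density M (indicator A)) f z = pp_op M (\<lambda>w. indicator A w * f w) z"
  unfolding pp_op_def by (subst nn_integral_density) (auto simp: mult_ac)

lemma pp_op_restrict_plus:
  assumes [measurable]: "A \<in> sets M" "f \<in> borel_measurable M"
  shows "pp_op M f z = pp_op M (\<lambda>w. indicator A w * f w) z + pp_op M (\<lambda>w. indicator (space M - A) w * f w) z"
  unfolding pp_op_def
  by (subst nn_integral_add[symmetric], measurable) (auto intro!: nn_integral_cong simp: indicator_def)

end

text \<open>The comparison of kernels transfers the principle to the exact operator. The constant h
  is fixed before M because the principle is applied to restrictions of a given measure.\<close>

lemma pp_op_weak_maximum_principle:
  "\<exists>h>0. \<forall>(M :: ('a::euclidean_space \<times> real) measure) S m z. halfspace_measure M \<longrightarrow> (AE w in M. w \<in> S) \<longrightarrow>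
     (\<forall>w\<in>S. snd w > 0 \<and> pp_op M (\<lambda>_. 1) w \<le> m) \<longrightarrow> snd z > 0 \<longrightarrow> pp_op M (\<lambda>_. 1) z \<le> ennreal h * m"
proof -
  obtain c C where c: "c > 0" and C: "C > 0" and
    bd: "\<And>z w :: 'a \<times> real. snd z > 0 \<Longrightarrow> snd w > 0 \<Longrightarrow> ennreal c * ennreal (pp_cmp z w) \<le> pp_kernel z w"
        "\<And>z w :: 'a \<times> real. snd z > 0 \<Longrightarrow> snd w > 0 \<Longrightarrow> pp_kernel z w \<le> ennreal C * ennreal (pp_cmp z w)"
    using pp_kernel_bounds[where 'a='a] by blast
  let ?W = "wmp_const TYPE('a)"
  have W: "?W > 0" by (rule wmp_const_pos)
  have "pp_op M (\<lambda>_. 1) z \<le> ennreal (C * ?W / c) * m"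
    if M: "halfspace_measure M" and ae: "AE w in M. w \<in> S"
      and S: "\<forall>w\<in>S. snd w > 0 \<and> pp_op M (\<lambda>_. 1) w \<le> m" and z: "snd z > 0"
    for M :: "('a \<times> real) measure" and S m z
  proof -
    interpret halfspace_measure M by (rule M)
    have "potential w \<le> ennreal (1 / c) * m" if "w \<in> S" for w
    proof -
      have "ennreal c * potential w = (\<integral>\<^sup>+ v. ennreal c * ennreal (pp_cmp w v) \<partial>M)"
        unfolding potential_def by (rule nn_integral_cmult[symmetric]) measurable
      also have "\<dots> \<le> pp_op M (\<lambda>_. 1) w"
        unfolding pp_op_def using S that snd_pos by (intro nn_integral_mono) (auto intro!: bd)
      also have "\<dots> \<le> m" using S that by auto
      finally have "ennreal (1 / c) * (ennreal c * potential w) \<le> ennreal (1 / c) * m"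
        by (intro mult_left_mono) auto
      thus ?thesis using c by (simp add: mult.assoc[symmetric] ennreal_mult[symmetric])
    qed
    hence "potential z \<le> ennreal ?W * (ennreal (1 / c) * m)"
      using S by (intro weak_maximum_principle[OF ae _ _ z]) auto
    hence *: "ennreal C * potential z \<le> ennreal C * (ennreal ?W * (ennreal (1 / c) * m))"
      by (intro mult_left_mono) auto
    have "pp_op M (\<lambda>_. 1) z \<le> (\<integral>\<^sup>+ v. ennreal C * ennreal (pp_cmp z v) \<partial>M)"
      unfolding pp_op_def using z snd_pos by (intro nn_integral_mono) (auto intro!: bd)
    also have "\<dots> = ennreal C * potential z"
      unfolding potential_def by (rule nn_integral_cmult) measurable
    also note *
    also have "ennreal C * (ennreal ?W * (ennreal (1 / c) * m)) = ennreal (C * ?W / c) * m"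
      using c C W by (simp add: mult.assoc[symmetric] ennreal_mult[symmetric])
    finally show ?thesis .
  qed
  thus ?thesis using c C W by (intro exI[of _ "C * ?W / c"]) auto
qed

text \<open>Restricted to the set where the potential is at most b/(2h), the measure has potential
  at most b/2 at z by the maximum principle. For b the full potential at z, the rest of the measure
  supplies at least b/2, and there the integrand exceeds (b/(2h))^s. One c serves all measures, in
  particular \<sigma> and its truncations.\<close>

lemma pp_op_power_lower_bound:
  assumes s: "s > 0"
  shows "\<exists>c>0. \<forall>(M :: ('a::euclidean_space \<times> real) measure) z. halfspace_measure M \<longrightarrow> snd z > 0 \<longrightarrow>
     ennreal c * epowr (pp_op M (\<lambda>_. 1) z) (1 + s) \<le> pp_op M (\<lambda>w. epowr (pp_op M (\<lambda>_. 1) w) s) z"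
proof -
  obtain h where h: "h > 0" and wmp: "\<And>(M :: ('a::euclidean_space \<times> real) measure) S m z. halfspace_measure M \<Longrightarrow>
     (AE w in M. w \<in> S) \<Longrightarrow> (\<And>w. w \<in> S \<Longrightarrow> snd w > 0 \<and> pp_op M (\<lambda>_. 1) w \<le> m) \<Longrightarrow> snd z > 0 \<Longrightarrow>
     pp_op M (\<lambda>_. 1) z \<le> ennreal h * m"
    using pp_op_weak_maximum_principle[where 'a='a] by metis
  \<comment> \<open>Half of the potential survives the split, weighted by the power s of the
    level.\<close>
  define c where "c = (1 / (2 * h)) powr s / 2"
  have "ennreal c * epowr (pp_op M (\<lambda>_. 1) z) (1 + s) \<le> pp_op M (\<lambda>w. epowr (pp_op M (\<lambda>_. 1) w) s) z"
    if M: "halfspace_measure M" and z: "snd z > 0" for M :: "('a \<times> real) measure" and z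
  proof -
    interpret halfspace_measure M by (rule M)
    let ?V = "pp_op M (\<lambda>_. 1)"
    define A where "A b = {w \<in> space M. ?V w \<le> ennreal (b / (2 * h))}" for b
    have A [measurable]: "A b \<in> sets M" for b unfolding A_def by measurable
    let ?X = "\<lambda>b. pp_op M (\<lambda>w. indicator (A b) w * 1) z"
    let ?Y = "\<lambda>b. pp_op M (\<lambda>w. indicator (space M - A b) w * 1) z"
    have split: "?V z = ?X b + ?Y b" for b by (rule pp_op_restrict_plus) measurable
    have X: "?X b \<le> ennreal (b / 2)" if "b > 0" for b
    proof -
      have "pp_op (density M (indicator (A b))) (\<lambda>_. 1) z \<le> ennreal h * ennreal (b / (2 * h))"
      proof (rule wmp)
        show "halfspace_measure (density M (indicator (A b)))"
          by (rule halfspace_measure_density_indicator) measurable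
        show "AE w in density M (indicator (A b)). w \<in> A b"
          by (subst AE_density) (auto simp: indicator_def)
        show "snd z > 0" by (rule z)
        fix w assume w: "w \<in> A b"
        have "pp_op (density M (indicator (A b))) (\<lambda>_. 1) w \<le> ?V w"
          by (subst pp_op_density_indicator) (auto intro!: pp_op_mono simp: indicator_def)
        also have "\<dots> \<le> ennreal (b / (2 * h))" using w by (simp add: A_def)
        finally show "snd w > 0 \<and> pp_op (density M (indicator (A b))) (\<lambda>_. 1) w \<le> ennreal (b / (2 * h))"
          using w snd_pos by (auto simp: A_def)
      qed
      also have "ennreal h * ennreal (b / (2 * h)) = ennreal (b / 2)"
        using h that by (simp add: ennreal_mult[symmetric])
      finally show ?thesis by (simp add: pp_op_density_indicator)
    qed
    have Y: "ennreal ((b / (2 * h)) powr s) * ?Y b \<le> pp_op M (\<lambda>w. epowr (?V w) s) z" if "b > 0" for b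
    proof -
      have "ennreal ((b / (2 * h)) powr s) * ?Y b = pp_op M (\<lambda>w. ennreal ((b / (2 * h)) powr s) * (indicator (space M - A b) w * 1)) z"
        by (rule pp_op_cmult[symmetric]) measurable
      also have "\<dots> \<le> pp_op M (\<lambda>w. epowr (?V w) s) z"
      proof (rule pp_op_mono)
        fix w assume w: "w \<in> space M"
        show "ennreal ((b / (2 * h)) powr s) * (indicator (space M - A b) w * 1) \<le> epowr (?V w) s"
        proof (cases "w \<in> A b")
          case False
          hence "ennreal (b / (2 * h)) \<le> ?V w" using w by (auto simp: A_def)
          from epowr_mono[OF s this] show ?thesis using that h False w by simp
        qed simp
      qed
      finally show ?thesis .
    qed
    show ?thesis
    proof (cases "?V z")
      case (real a)
      show ?thesis
      proof (cases "a = 0")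
        case False
        hence a: "a > 0" using real by simp
        have "ennreal (a / 2) + ennreal (a / 2) \<le> ?X a + ?Y a"
          using split[of a] real a by (simp add: ennreal_plus[symmetric] del: ennreal_plus)
        also have "\<dots> \<le> ennreal (a / 2) + ?Y a" by (intro add_right_mono X a)
        finally have "ennreal (a / 2) \<le> ?Y a" by (simp add: ennreal_add_left_cancel_le)
        hence "ennreal ((a / (2 * h)) powr s) * ennreal (a / 2) \<le> ennreal ((a / (2 * h)) powr s) * ?Y a"
          by (rule mult_left_mono) simp
        also note Y[OF a]
        also have "ennreal ((a / (2 * h)) powr s) * ennreal (a / 2) = ennreal c * epowr (?V z) (1 + s)"
          using a h unfolding real(2) c_def
          by (simp add: ennreal_mult[symmetric] powr_divide powr_add powr_mult)
        finally show ?thesis .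
      qed (use real s in simp)
    next
      case top
      \<comment> \<open>With an infinite potential any finite level will do. b = 2h makes the level
        and its power equal to 1; the low part is finite, so the high part is infinite.\<close>
      have "?X (2 * h) < \<infinity>" using X[of "2 * h"] h by (simp add: order_le_less_trans)
      hence "?Y (2 * h) = \<infinity>" using split[of "2 * h"] top
        by (metis ennreal_add_eq_top infinity_ennreal_def less_irrefl)
      thus ?thesis using Y[of "2 * h"] h s by (simp add: ennreal_mult_top top_unique)
    qed
  qed
  moreover have "c > 0" using h by (simp add: c_def)
  ultimately show ?thesis by blast
qed

section \<open>Locally finite measures and the trace inequality\<close>

context
  fixes X :: "'z::second_countable_topology set" and \<mu> :: "'z measure"
  assumes lfb: "\<mu> \<in> locally_finite_borel_measures X"
begin

lemma locally_finite_sets: "sets \<mu> = sets (restrict_space borel X)"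
  using lfb by (simp add: locally_finite_borel_measures_def)

lemma locally_finite_space: "space \<mu> = X"
  using sets_eq_imp_space_eq[OF locally_finite_sets] by (simp add: space_restrict_space)

lemma locally_finite_open_in_sets: "open U \<Longrightarrow> U \<inter> X \<in> sets \<mu>"
  by (auto simp: locally_finite_sets sets_restrict_space)

lemma locally_finite_nbhd:
  obtains U where "\<And>x. x \<in> X \<Longrightarrow> open (U x)" "\<And>x. x \<in> X \<Longrightarrow> x \<in> U x"
    "\<And>x. x \<in> X \<Longrightarrow> emeasure \<mu> (U x \<inter> X) < \<infinity>"
proof -
  have "\<forall>x\<in>X. \<exists>U. open U \<and> x \<in> U \<and> emeasure \<mu> (U \<inter> X) < \<infinity>"
    using lfb by (simp add: locally_finite_borel_measures_def)
  from bchoice[OF this] show ?thesis using that by blast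
qed

lemma locally_finite_sigma_finite: "sigma_finite_measure \<mu>"
proof -
  obtain U where U: "\<And>x. x \<in> X \<Longrightarrow> open (U x)" "\<And>x. x \<in> X \<Longrightarrow> x \<in> U x"
    "\<And>x. x \<in> X \<Longrightarrow> emeasure \<mu> (U x \<inter> X) < \<infinity>" using locally_finite_nbhd by blast
  obtain F where F: "F \<subseteq> U ` X" "countable F" "\<Union>F = \<Union>(U ` X)"
    using Lindelof[of "U ` X"] U(1) by auto
  show ?thesis
  proof
    show "\<exists>A. countable A \<and> A \<subseteq> sets \<mu> \<and> \<Union>A = space \<mu> \<and> (\<forall>a\<in>A. emeasure \<mu> a \<noteq> \<infinity>)"
    proof (intro exI[of _ "(\<lambda>V. V \<inter> X) ` F"] conjI)
      show "(\<lambda>V. V \<inter> X) ` F \<subseteq> sets \<mu>" using F(1) U(1) locally_finite_open_in_sets by auto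
      show "\<Union>((\<lambda>V. V \<inter> X) ` F) = space \<mu>" using F(3) U(2) by (auto simp: locally_finite_space)
      show "\<forall>a\<in>(\<lambda>V. V \<inter> X) ` F. emeasure \<mu> a \<noteq> \<infinity>"
      proof
        fix a assume "a \<in> (\<lambda>V. V \<inter> X) ` F"
        then obtain x where "x \<in> X" "a = U x \<inter> X" using F(1) by blast
        thus "emeasure \<mu> a \<noteq> \<infinity>" using U(3)[of x] by simp
      qed
    qed (rule countable_image[OF F(2)])
  qed
qed

lemma locally_finite_compact:
  assumes "compact K" "K \<subseteq> X"
  shows "emeasure \<mu> K < \<infinity>"
proof -
  obtain U where U: "\<And>x. x \<in> X \<Longrightarrow> open (U x)" "\<And>x. x \<in> X \<Longrightarrow> x \<in> U x"
    "\<And>x. x \<in> X \<Longrightarrow> emeasure \<mu> (U x \<inter> X) < \<infinity>" using locally_finite_nbhd by blast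
  have op: "open (U x)" if "x \<in> K" for x using U(1) assms(2) that by auto
  have cov: "K \<subseteq> (\<Union>x\<in>K. U x)" using U(2) assms(2) by auto
  obtain C where C: "C \<subseteq> K" "finite C" "K \<subseteq> (\<Union>x\<in>C. U x)"
    using compactE_image[OF assms(1) op cov] by metis
  have sub: "K \<subseteq> (\<Union>x\<in>C. U x \<inter> X)" using C assms(2) by auto
  have opn: "U x \<inter> X \<in> sets \<mu>" if "x \<in> X" for x
    using U(1)[OF that] by (rule locally_finite_open_in_sets)
  have "emeasure \<mu> K \<le> emeasure \<mu> (\<Union>x\<in>C. U x \<inter> X)"
    using C(1,2) assms(2) by (intro emeasure_mono sub sets.finite_UN opn) auto
  also have "\<dots> \<le> (\<Sum>x\<in>C. emeasure \<mu> (U x \<inter> X))"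
    using C(1,2) assms(2) opn by (intro emeasure_subadditive_finite) auto
  also have "\<dots> < \<infinity>"
    using C(1) assms(2) U(3) by (subst infinity_ennreal_def, subst ennreal_sum_less_top[OF C(2)]) auto
  finally show ?thesis .
qed

end

lemma finite_measure_locally_finite:
  assumes "sets \<nu> = sets borel" "emeasure \<nu> UNIV < \<infinity>"
  shows "\<nu> \<in> locally_finite_borel_measures UNIV"
proof -
  have "sets \<nu> = sets (restrict_space borel UNIV)"
    using assms(1) by (simp add: sets_restrict_space)
  moreover have "\<exists>U. open U \<and> x \<in> U \<and> emeasure \<nu> (U \<inter> UNIV) < \<infinity>" for x
    using assms(2) by (intro exI[of _ UNIV]) simp
  ultimately show ?thesis unfolding locally_finite_borel_measures_def by blast
qed

lemma halfspace_measure_locally_finite: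
  assumes "\<sigma> \<in> locally_finite_borel_measures (halfspace :: ('a::euclidean_space \<times> real) set)"
  shows "halfspace_measure \<sigma>"
proof -
  note s = locally_finite_sets[OF assms]
  have "fst \<in> borel_measurable \<sigma>" "snd \<in> borel_measurable \<sigma>"
    unfolding measurable_cong_sets[OF s refl]
    by (intro measurable_restrict_space1 borel_measurable_continuous_onI continuous_intros)+
  thus ?thesis
    using locally_finite_sigma_finite[OF assms] locally_finite_space[OF assms]
    by (auto simp: halfspace_measure_def halfspace_measure_axioms_def halfspace_def)
qed

text \<open>Compact pieces that stay away from the boundary, where local finiteness gives no
  control: each has finite measure, and its points have height at least 1/(k+1).\<close>

definition exhaustion :: "nat \<Rightarrow> ('a::euclidean_space \<times> real) set" where
  "exhaustion k = cball 0 (real (Suc k)) \<inter> {z. 1 / real (Suc k) \<le> snd z}"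

lemma compact_exhaustion: "compact (exhaustion k)"
  unfolding exhaustion_def
  by (intro compact_Int_closed compact_cball closed_Collect_le continuous_intros)

lemma exhaustion_snd: "z \<in> exhaustion k \<Longrightarrow> snd z \<ge> 1 / real (Suc k)" "z \<in> exhaustion k \<Longrightarrow> snd z > 0"
  by (auto simp: exhaustion_def intro: less_le_trans[of 0 "1 / real (Suc k)"])

lemma exhaustion_subset: "exhaustion k \<subseteq> halfspace"
  using exhaustion_snd(2) by (auto simp: halfspace_def)

lemma exhaustion_mono: "j \<le> k \<Longrightarrow> exhaustion j \<subseteq> exhaustion k"
proof
  fix z :: "'a \<times> real" assume "j \<le> k" "z \<in> exhaustion j"
  moreover from this have "1 / real (Suc k) \<le> 1 / real (Suc j)" by (intro divide_left_mono) auto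
  ultimately show "z \<in> exhaustion k" by (auto simp: exhaustion_def)
qed

lemma exhaustion_covers:
  assumes "z \<in> halfspace"
  obtains k where "z \<in> exhaustion k"
proof -
  have "snd z > 0" using assms by (auto simp: halfspace_def)
  then obtain i where i: "inverse (real (Suc i)) < snd z" using reals_Archimedean by auto
  obtain j where j: "norm z \<le> real j" using real_arch_simple by auto
  have "1 / real (Suc (max i j)) \<le> inverse (real (Suc i))" by (simp add: inverse_eq_divide divide_left_mono)
  hence "z \<in> exhaustion (max i j)" using i j by (auto simp: exhaustion_def)
  thus ?thesis by (rule that)
qed

lemma exhaustion_in_sets:
  assumes "\<sigma> \<in> locally_finite_borel_measures (halfspace :: ('a::euclidean_space \<times> real) set)"
  shows "exhaustion k \<in> sets \<sigma>"
proof -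
  have "exhaustion k \<in> sets (borel :: ('a \<times> real) measure)"
    by (intro borel_closed compact_imp_closed compact_exhaustion)
  moreover have "exhaustion k = halfspace \<inter> (exhaustion k :: ('a \<times> real) set)" using exhaustion_subset by auto
  ultimately show ?thesis unfolding locally_finite_sets[OF assms] sets_restrict_space by blast
qed

text \<open>The inequality is tested on the boundary measure \<open>P*(f dM) dt\<close>. Its total
  mass is the integral of f, because the Poisson kernel integrates to 1 over the boundary;
  finiteness of that mass makes it admissible.\<close>

lemma (in halfspace_measure) trace_ineq_pp_op:
  assumes tr: "poisson_trace_ineq q M \<kappa>" and f [measurable]: "f \<in> borel_measurable M"
    and fin: "(\<integral>\<^sup>+ w. f w \<partial>M) < \<infinity>"
  shows "Lq_norm q M (pp_op M f) \<le> ennreal \<kappa> * (\<integral>\<^sup>+ w. f w \<partial>M)"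
proof -
  define \<nu> where "\<nu> = density lborel (poisson_adj (density M f))"
  interpret pair_sigma_finite M "lborel :: 'a measure" by unfold_locales
  have "emeasure \<nu> UNIV = (\<integral>\<^sup>+ t. (\<integral>\<^sup>+ w. f w * ennreal (poisson_kernel (fst w - t) (snd w)) \<partial>M) \<partial>lborel)"
    unfolding \<nu>_def by (subst emeasure_density) (simp_all add: poisson_adj_density)
  also have "\<dots> = (\<integral>\<^sup>+ w. (\<integral>\<^sup>+ t. f w * ennreal (poisson_kernel (fst w - t) (snd w)) \<partial>lborel) \<partial>M)"
    by (rule Fubini') measurable
  also have "\<dots> = (\<integral>\<^sup>+ w. f w \<partial>M)"
  proof (intro nn_integral_cong)
    fix w assume "w \<in> space M"
    thus "(\<integral>\<^sup>+ t. f w * ennreal (poisson_kernel (fst w - t) (snd w)) \<partial>lborel) = f w"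
      by (subst nn_integral_cmult) (auto simp: nn_integral_poisson_kernel snd_pos)
  qed
  finally have mass: "emeasure \<nu> UNIV = (\<integral>\<^sup>+ w. f w \<partial>M)" .
  have "\<nu> \<in> locally_finite_borel_measures UNIV"
    using fin by (intro finite_measure_locally_finite) (simp_all add: mass, simp add: \<nu>_def)
  hence "Lq_norm q M (poisson \<nu>) \<le> ennreal \<kappa> * emeasure \<nu> UNIV"
    using tr by (simp add: poisson_trace_ineq_def)
  moreover have "poisson \<nu> = pp_op M f"
    unfolding \<nu>_def poisson_poisson_adj_density[OF f, symmetric] poisson_poisson_adj_def ..
  ultimately show ?thesis by (simp add: mass)
qed

text \<open>For I the integral of f^q, the trace inequality gives I^(1/q) \<le> \<kappa> I. As q <
  1, dividing by I leaves a positive power of I on the left; the division is legitimate only for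
  finite I, whence the hypothesis \<open>fin\<close>.\<close>

lemma (in halfspace_measure) subsolution_Lq_bound:
  assumes q: "0 < q" "q < 1" and tr: "poisson_trace_ineq q M \<kappa>" and \<kappa>: "\<kappa> > 0"
    and f [measurable]: "f \<in> borel_measurable M"
    and le: "\<And>w. w \<in> space M \<Longrightarrow> f w \<le> pp_op M (\<lambda>w. epowr (f w) q) w"
    and fin: "(\<integral>\<^sup>+ w. epowr (f w) q \<partial>M) < \<infinity>"
  shows "(\<integral>\<^sup>+ w. epowr (f w) q \<partial>M) \<le> ennreal (\<kappa> powr (q / (1 - q)))"
proof -
  define I where "I = (\<integral>\<^sup>+ w. epowr (f w) q \<partial>M)"
  obtain i where i: "I = ennreal i" "i \<ge> 0" using fin by (cases I) (auto simp: I_def)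
  have "I \<le> (\<integral>\<^sup>+ w. epowr (pp_op M (\<lambda>w. epowr (f w) q) w) q \<partial>M)"
    unfolding I_def by (intro nn_integral_mono epowr_mono q le)
  hence "epowr I (1 / q) \<le> Lq_norm q M (pp_op M (\<lambda>w. epowr (f w) q))"
    unfolding Lq_norm_def using q by (intro epowr_mono) auto
  also have "\<dots> \<le> ennreal \<kappa> * I"
    unfolding I_def by (rule trace_ineq_pp_op[OF tr _ fin]) measurable
  finally have *: "i powr (1 / q) \<le> \<kappa> * i"
    using i \<kappa> by (simp add: ennreal_mult[symmetric])
  show ?thesis
  proof (cases "i = 0")
    case False
    hence ip: "i > 0" using i by simp
    have "i powr ((1 - q) / q) = i powr (1 / q) / i"
      using q ip by (simp add: powr_diff diff_divide_distrib)
    also have "\<dots> \<le> \<kappa>" using * ip by (simp add: field_simps)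
    finally have "(i powr ((1 - q) / q)) powr (q / (1 - q)) \<le> \<kappa> powr (q / (1 - q))"
      using q by (intro powr_mono2) auto
    hence "i \<le> \<kappa> powr (q / (1 - q))" using q ip by (simp add: powr_powr)
    thus ?thesis using i by (simp add: I_def[symmetric] ennreal_leI)
  qed (use i in \<open>simp add: I_def[symmetric]\<close>)
qed

text \<open>A bound uniform in the second point; it makes potentials of finite measures finite at
  every point of the half-space.\<close>

lemma pp_kernel_upper_bound:
  "\<exists>C>0. \<forall>z w :: 'a::euclidean_space \<times> real. snd z > 0 \<longrightarrow> snd w > 0 \<longrightarrow>
     pp_kernel z w \<le> ennreal (C / snd z ^ DIM('a))"
proof -
  obtain C where C: "C > 0" and
    bd: "\<And>z w :: 'a \<times> real. snd z > 0 \<Longrightarrow> snd w > 0 \<Longrightarrow> pp_kernel z w \<le> ennreal C * ennreal (pp_cmp z w)"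
    using pp_kernel_bounds[where 'a='a] by blast
  have "pp_kernel z w \<le> ennreal (C / snd z ^ DIM('a))" if "snd z > 0" "snd w > 0" for z w :: "'a \<times> real"
  proof -
    have "pp_cmp z w \<le> 1 / (snd z + snd w) ^ DIM('a)" unfolding pp_cmp_def using that by (intro poisson_cmp_le) simp
    also have "\<dots> \<le> 1 / snd z ^ DIM('a)" using that by (intro divide_left_mono power_mono) auto
    finally have "C * pp_cmp z w \<le> C * (1 / snd z ^ DIM('a))" using C by (intro mult_left_mono) auto
    hence "ennreal C * ennreal (pp_cmp z w) \<le> ennreal (C / snd z ^ DIM('a))"
      using C that pp_cmp_pos[of z w] by (simp add: ennreal_mult[symmetric] ennreal_leI)
    thus ?thesis using bd[OF that] by (rule order_trans[rotated])
  qed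
  thus ?thesis using C by blast
qed

section \<open>Monotone iteration\<close>

text \<open>\<open>lower_bound\<close> is assumed for all measures because it is applied to
  truncations of \<sigma> as well. Only c enters the condition on \<open>c\<^sub>0\<close>, so that
  \<open>c\<^sub>0\<close> depends neither on \<sigma> nor on \<kappa>.\<close>

locale poisson_iteration = halfspace_measure \<sigma>
  for \<sigma> :: "('a::euclidean_space \<times> real) measure" +
  fixes q \<kappa> c c\<^sub>0 :: real
  assumes q: "0 < q" "q < 1"
    and locally_finite: "\<sigma> \<in> locally_finite_borel_measures halfspace"
    and \<kappa>: "\<kappa> > 0" and trace: "poisson_trace_ineq q \<sigma> \<kappa>"
    and c0: "c\<^sub>0 > 0" "c\<^sub>0 powr (1 - q) \<le> c"
    and lower_bound: "\<And>(M :: ('a \<times> real) measure) z. halfspace_measure M \<Longrightarrow> snd z > 0 \<Longrightarrow>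
      ennreal c * epowr (pp_op M (\<lambda>_. 1) z) (1 + q / (1 - q)) \<le> pp_op M (\<lambda>w. epowr (pp_op M (\<lambda>_. 1) w) (q / (1 - q))) z"
begin

abbreviation "u0 M z \<equiv> ennreal c\<^sub>0 * epowr (pp_op M (\<lambda>_. 1) z) (1 / (1 - q))"

abbreviation "iter \<equiv> poisson_iter q \<sigma> c\<^sub>0"

lemma space_eq: "space \<sigma> = halfspace"
  by (rule locally_finite_space[OF locally_finite])

lemma epowr_u0: "epowr (u0 M z) q = ennreal (c\<^sub>0 powr q) * epowr (pp_op M (\<lambda>_. 1) z) (q / (1 - q))"
  using c0 by (simp add: epowr_cmult epowr_epowr)

text \<open>Write V for the potential of M and s = q/(1-q). Then \<open>u0\<close> to the power q is
  \<open>c\<^sub>0 powr q\<close> times V^s, whose potential is at least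
  \<open>c\<^sub>0 powr q * c\<close> times V^(1+s). Since 1 + s = 1/(1-q), the condition
  \<open>c\<^sub>0 powr (1 - q) \<le> c\<close> suffices.\<close>

lemma u0_le:
  fixes M :: "('a \<times> real) measure"
  assumes M: "halfspace_measure M" and z: "snd z > 0"
  shows "u0 M z \<le> pp_op M (\<lambda>w. epowr (u0 M w) q) z"
proof -
  interpret M: halfspace_measure M by (rule M)
  have e: "1 / (1 - q) = 1 + q / (1 - q)" using q by (simp add: field_simps)
  have "c\<^sub>0 = c\<^sub>0 powr q * c\<^sub>0 powr (1 - q)" using c0 by (simp add: powr_add[symmetric])
  also have "\<dots> \<le> c\<^sub>0 powr q * c" using c0 by (intro mult_left_mono) auto
  finally have "c\<^sub>0 \<le> c\<^sub>0 powr q * c" .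
  moreover have "c > 0" 
    using less_le_trans[OF _ c0(2), of 0] c0(1) by simp
  ultimately have "u0 M z \<le> (ennreal (c\<^sub>0 powr q) * ennreal c) * epowr (pp_op M (\<lambda>_. 1) z) (1 / (1 - q))"
    by (intro mult_right_mono) (auto simp: ennreal_mult[symmetric] intro: ennreal_leI)
  also have "\<dots> \<le> ennreal (c\<^sub>0 powr q) * pp_op M (\<lambda>w. epowr (pp_op M (\<lambda>_. 1) w) (q / (1 - q))) z"
    unfolding e mult.assoc by (rule mult_left_mono[OF lower_bound[OF M z]]) simp
  also have "\<dots> = pp_op M (\<lambda>w. epowr (u0 M w) q) z"
    unfolding epowr_u0 by (rule M.pp_op_cmult[symmetric]) measurable
  finally show ?thesis .
qed

text \<open>The truncation makes the integral finite, which \<open>subsolution_Lq_bound\<close> needs a priori.\<close>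

lemma truncated_u0_Lq:
  fixes k
  defines "N \<equiv> density \<sigma> (indicator (exhaustion k))"
  shows "(\<integral>\<^sup>+ w. indicator (exhaustion k) w * epowr (u0 N w) q \<partial>\<sigma>) \<le> ennreal (\<kappa> powr (q / (1 - q)))"
proof -
  have K [measurable]: "exhaustion k \<in> sets \<sigma>" by (rule exhaustion_in_sets[OF locally_finite])
  have hN: "halfspace_measure N" unfolding N_def by (rule halfspace_measure_density_indicator[OF K])
  have Nop: "pp_op N f z = pp_op \<sigma> (\<lambda>w. indicator (exhaustion k) w * f w) z" if "f \<in> borel_measurable \<sigma>" for f z
    unfolding N_def by (rule pp_op_density_indicator[OF K that])
  have "pp_op N (\<lambda>_. 1) = pp_op \<sigma> (\<lambda>w. indicator (exhaustion k) w * 1)" by (rule ext, rule Nop) simp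
  hence [measurable]: "pp_op N (\<lambda>_. 1) \<in> borel_measurable \<sigma>" by simp
  \<comment> \<open>Cut off outside \<open>exhaustion k\<close>, the subsolution \<open>u0 N\<close>
    for N becomes a subsolution for \<sigma>, to which the trace inequality applies.\<close>
  define f where "f w = indicator (exhaustion k) w * u0 N w" for w
  have [measurable]: "f \<in> borel_measurable \<sigma>" unfolding f_def by measurable
  have fq: "epowr (f w) q = indicator (exhaustion k) w * epowr (u0 N w) q" for w
    by (simp add: f_def indicator_def)
  obtain C where C: "C > 0" and
    bd: "\<And>z w :: 'a \<times> real. snd z > 0 \<Longrightarrow> snd w > 0 \<Longrightarrow> pp_kernel z w \<le> ennreal (C / snd z ^ DIM('a))"
    using pp_kernel_upper_bound[where 'a='a] by blast
  \<comment> \<open>On \<open>exhaustion k\<close> heights are at least 1/(k+1), so the kernel is at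
    most C (k+1)^n and the truncated potential at most B.\<close>
  define B where "B = ennreal (C * real (Suc k) ^ DIM('a)) * emeasure \<sigma> (exhaustion k)"
  have fin: "emeasure \<sigma> (exhaustion k) < \<infinity>"
    by (rule locally_finite_compact[OF locally_finite compact_exhaustion exhaustion_subset])
  have B: "B < \<infinity>" unfolding B_def using fin by (simp add: ennreal_mult_less_top)
  have Vb: "pp_op N (\<lambda>_. 1) z \<le> B" if z: "z \<in> exhaustion k" for z
  proof -
    have "pp_op N (\<lambda>_. 1) z = pp_op \<sigma> (\<lambda>w. indicator (exhaustion k) w * 1) z" by (rule Nop) simp
    also have "\<dots> \<le> (\<integral>\<^sup>+ w. ennreal (C * real (Suc k) ^ DIM('a)) * indicator (exhaustion k) w \<partial>\<sigma>)"
      unfolding pp_op_def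
    proof (intro nn_integral_mono)
      fix w assume "w \<in> space \<sigma>"
      have "pp_kernel z w \<le> ennreal (C / snd z ^ DIM('a))"
        by (intro bd snd_pos[OF \<open>w \<in> space \<sigma>\<close>] exhaustion_snd(2)[OF z])
      also have "C / snd z ^ DIM('a) \<le> C * real (Suc k) ^ DIM('a)"
      proof -
        have "(1 / real (Suc k)) ^ DIM('a) \<le> snd z ^ DIM('a)"
          using exhaustion_snd(1)[OF z] by (intro power_mono) auto
        hence "C / snd z ^ DIM('a) \<le> C / (1 / real (Suc k)) ^ DIM('a)"
          using C exhaustion_snd(2)[OF z] by (intro divide_left_mono mult_pos_pos zero_less_power) auto
        thus ?thesis by (simp add: power_one_over)
      qed
      finally show "pp_kernel z w * (indicator (exhaustion k) w * 1)
          \<le> ennreal (C * real (Suc k) ^ DIM('a)) * indicator (exhaustion k) w"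
        by (simp add: indicator_def ennreal_leI)
    qed
    also have "\<dots> = B" unfolding B_def by (rule nn_integral_cmult_indicator[OF K])
    finally show ?thesis .
  qed
  have "(\<integral>\<^sup>+ w. epowr (f w) q \<partial>\<sigma>) \<le> (\<integral>\<^sup>+ w. (ennreal (c\<^sub>0 powr q) * epowr B (q / (1 - q))) * indicator (exhaustion k) w \<partial>\<sigma>)"
    unfolding fq epowr_u0
  proof (intro nn_integral_mono)
    fix w
    show "indicator (exhaustion k) w * (ennreal (c\<^sub>0 powr q) * epowr (pp_op N (\<lambda>_. 1) w) (q / (1 - q)))
        \<le> (ennreal (c\<^sub>0 powr q) * epowr B (q / (1 - q))) * indicator (exhaustion k) w"
      using Vb[of w] q by (cases "w \<in> exhaustion k") (auto intro!: mult_left_mono epowr_mono)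
  qed
  also have "\<dots> = (ennreal (c\<^sub>0 powr q) * epowr B (q / (1 - q))) * emeasure \<sigma> (exhaustion k)"
    by (rule nn_integral_cmult_indicator[OF K])
  also have "\<dots> < \<infinity>" using B fin epowr_lt_top_iff[of B "q / (1 - q)"]
    by (simp add: ennreal_mult_less_top)
  finally have "(\<integral>\<^sup>+ w. epowr (f w) q \<partial>\<sigma>) < \<infinity>" .
  hence "(\<integral>\<^sup>+ w. epowr (f w) q \<partial>\<sigma>) \<le> ennreal (\<kappa> powr (q / (1 - q)))"
  proof (intro subsolution_Lq_bound[OF q trace \<kappa>])
    fix w assume w: "w \<in> space \<sigma>"
    have "f w \<le> u0 N w" by (simp add: f_def indicator_def)
    also have "\<dots> \<le> pp_op N (\<lambda>w. epowr (u0 N w) q) w" by (rule u0_le[OF hN snd_pos[OF w]])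
    also have "\<dots> = pp_op \<sigma> (\<lambda>w. epowr (f w) q) w"
      unfolding fq by (rule Nop) measurable
    finally show "f w \<le> pp_op \<sigma> (\<lambda>w. epowr (f w) q) w" .
  qed measurable
  thus ?thesis unfolding fq .
qed

text \<open>The bound for the truncations does not depend on k, and the truncated potentials
  increase to the full one, so monotone convergence applies twice.\<close>

lemma u0_Lq: "(\<integral>\<^sup>+ w. epowr (u0 \<sigma> w) q \<partial>\<sigma>) \<le> ennreal (\<kappa> powr (q / (1 - q)))"
proof -
  let ?E = "exhaustion :: nat \<Rightarrow> ('a \<times> real) set"
  have E [measurable]: "?E k \<in> sets \<sigma>" for k by (rule exhaustion_in_sets[OF locally_finite])
  define N where "N k = density \<sigma> (indicator (?E k))" for k
  let ?V = "\<lambda>k z. pp_op \<sigma> (\<lambda>w. indicator (?E k) w) z"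
  have Nop: "pp_op (N k) (\<lambda>_. 1) = ?V k" for k
    unfolding N_def using pp_op_density_indicator[OF E, of "\<lambda>_. 1"] by (simp add: fun_eq_iff)
  have Vmono: "?V i z \<le> ?V j z" if "i \<le> j" for i j z
    using exhaustion_mono[OF that] by (intro pp_op_mono) (auto simp: indicator_def)
  define g where "g k w = indicator (?E k) w * epowr (u0 (N k) w) q" for k w
  have [measurable]: "g k \<in> borel_measurable \<sigma>" for k unfolding g_def Nop by measurable
  have gmono: "g i w \<le> g j w" if "i \<le> j" for i j w
    unfolding g_def epowr_u0 unfolding Nop using exhaustion_mono[OF that, where 'a='a] q
    by (intro mult_mono epowr_mono Vmono that) (auto simp: indicator_def)
  have V: "pp_op \<sigma> (\<lambda>_. 1) z = (SUP k. ?V k z)" for z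
  proof -
    have "pp_op \<sigma> (\<lambda>_. 1) z = (\<integral>\<^sup>+ w. (SUP k. pp_kernel z w * indicator (?E k) w) \<partial>\<sigma>)"
      unfolding pp_op_def
    proof (intro nn_integral_cong antisym)
      fix w assume "w \<in> space \<sigma>"
      then obtain k where "w \<in> ?E k" using exhaustion_covers space_eq by metis
      hence "pp_kernel z w * 1 = pp_kernel z w * indicator (?E k) w" by simp
      thus "pp_kernel z w * 1 \<le> (SUP k. pp_kernel z w * indicator (?E k) w)"
        by (rule order_trans[OF eq_refl SUP_upper[OF UNIV_I]])
      show "(SUP k. pp_kernel z w * indicator (?E k) w) \<le> pp_kernel z w * 1"
        by (intro SUP_least mult_left_mono) (auto simp: indicator_def)
    qed
    also have "\<dots> = (SUP k. ?V k z)"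
      unfolding pp_op_def
    proof (intro nn_integral_monotone_convergence_SUP)
      show "incseq (\<lambda>k w. pp_kernel z w * indicator (?E k) w)"
      proof (intro monoI le_funI mult_left_mono)
        fix i j :: nat and w :: "'a \<times> real" assume "i \<le> j"
        from exhaustion_mono[OF this, where 'a='a]
        show "indicator (?E i) w \<le> (indicator (?E j) w :: ennreal)" by (auto simp: indicator_def)
      qed simp
    qed measurable
    finally show ?thesis .
  qed
  have "(\<integral>\<^sup>+ w. epowr (u0 \<sigma> w) q \<partial>\<sigma>) \<le> (\<integral>\<^sup>+ w. (SUP k. g k w) \<partial>\<sigma>)"
  proof (intro nn_integral_mono)
    fix w assume "w \<in> space \<sigma>"
    then obtain k where k: "w \<in> ?E k" using exhaustion_covers space_eq by metis
    have "epowr (u0 \<sigma> w) q = (SUP j. ennreal (c\<^sub>0 powr q) * epowr (?V j w) (q / (1 - q)))"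
      unfolding epowr_u0 unfolding V using q by (subst epowr_SUP) (auto simp: SUP_mult_left_ennreal)
    also have "\<dots> \<le> (SUP k. g k w)"
    proof (intro SUP_least)
      fix j
      \<comment> \<open>In \<open>g\<close> a single index governs both the cut-off and the
        potential; \<open>max j k\<close> is large enough for both.\<close>
      have "ennreal (c\<^sub>0 powr q) * epowr (?V j w) (q / (1 - q)) \<le> ennreal (c\<^sub>0 powr q) * epowr (?V (max j k) w) (q / (1 - q))"
        using q by (intro mult_left_mono epowr_mono Vmono) auto
      also have "\<dots> = g (max j k) w"
        unfolding g_def epowr_u0 unfolding Nop using exhaustion_mono[of k "max j k"] k by auto
      also have "\<dots> \<le> (SUP k. g k w)" by (rule SUP_upper) simp
      finally show "ennreal (c\<^sub>0 powr q) * epowr (?V j w) (q / (1 - q)) \<le> (SUP k. g k w)" .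
    qed
    finally show "epowr (u0 \<sigma> w) q \<le> (SUP k. g k w)" .
  qed
  also have "\<dots> = (SUP k. \<integral>\<^sup>+ w. g k w \<partial>\<sigma>)"
    by (intro nn_integral_monotone_convergence_SUP monoI le_funI gmono) measurable
  also have "\<dots> \<le> ennreal (\<kappa> powr (q / (1 - q)))"
    unfolding g_def N_def by (intro SUP_least truncated_u0_Lq)
  finally show ?thesis .
qed

section \<open>The iterates and their limit\<close>

lemma poisson_poisson_adj_self: "poisson_poisson_adj \<sigma> = pp_op \<sigma> (\<lambda>_. 1)"
  using poisson_poisson_adj_density[of "\<lambda>_. 1"] by (simp add: density_1)

lemma iter_0: "iter 0 = u0 \<sigma>"
  by (simp add: fun_eq_iff poisson_poisson_adj_self)

text \<open>Proved together: the recursion in terms of \<open>pp_op\<close> needs measurability of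
  the current iterate, and measurability of the next iterate needs the recursion.\<close>

lemma iter_measurable [measurable]: "iter j \<in> borel_measurable \<sigma>"
  and iter_Suc: "iter (Suc j) = pp_op \<sigma> (\<lambda>w. epowr (iter j w) q)"
proof -
  have step: "iter (Suc j) = pp_op \<sigma> (\<lambda>w. epowr (iter j w) q)" if [measurable]: "iter j \<in> borel_measurable \<sigma>" for j
    unfolding poisson_iter.simps power_measure_def by (rule poisson_poisson_adj_density) measurable
  have *: "iter j \<in> borel_measurable \<sigma>" for j
  proof (induction j)
    case 0
    show ?case unfolding iter_0 by measurable
  next
    case (Suc j)
    note [measurable] = Suc
    show ?case unfolding step[OF Suc.IH] by measurable
  qed
  show "iter j \<in> borel_measurable \<sigma>" by (rule *)
  show "iter (Suc j) = pp_op \<sigma> (\<lambda>w. epowr (iter j w) q)" by (rule step[OF *])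
qed

lemma iter_le_Suc:
  assumes "z \<in> halfspace"
  shows "iter j z \<le> iter (Suc j) z"
  using assms
proof (induction j arbitrary: z)
  case 0
  thus ?case unfolding iter_Suc[of 0] unfolding iter_0
    by (intro u0_le halfspace_measure_axioms) (auto simp: halfspace_def)
next
  case (Suc j)
  show ?case unfolding iter_Suc[of "Suc j"] iter_Suc[of j] using Suc.IH q
    by (intro pp_op_mono epowr_mono) (auto simp: space_eq iter_Suc[symmetric] simp del: poisson_iter.simps)
qed

lemma iter_incseq: "z \<in> halfspace \<Longrightarrow> incseq (\<lambda>j. iter j z)"
  by (intro incseq_SucI iter_le_Suc)

text \<open>Since the iterates increase, each is a subsolution. The trace inequality for the
  preceding iterate serves only to show a finite integral; \<open>subsolution_Lq_bound\<close> then
  restores the same bound, so nothing deteriorates with j.\<close>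

lemma iter_Lq: "(\<integral>\<^sup>+ w. epowr (iter j w) q \<partial>\<sigma>) \<le> ennreal (\<kappa> powr (q / (1 - q)))"
proof (induction j)
  case 0
  show ?case unfolding iter_0 by (rule u0_Lq)
next
  case (Suc j)
  let ?I = "\<integral>\<^sup>+ w. epowr (iter j w) q \<partial>\<sigma>"
  have fin: "?I < \<infinity>" using Suc by (rule order_le_less_trans) simp
  show ?case
  proof (rule subsolution_Lq_bound[OF q trace \<kappa> iter_measurable])
    fix w assume "w \<in> space \<sigma>"
    thus "iter (Suc j) w \<le> pp_op \<sigma> (\<lambda>w. epowr (iter (Suc j) w) q) w"
      unfolding iter_Suc[of "Suc j", symmetric] space_eq by (rule iter_le_Suc)
  next
    have "Lq_norm q \<sigma> (iter (Suc j)) \<le> ennreal \<kappa> * ?I"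
      unfolding iter_Suc[of j] by (rule trace_ineq_pp_op[OF trace _ fin]) measurable
    also have "\<dots> < \<infinity>" using fin by (simp add: ennreal_mult_less_top)
    finally show "(\<integral>\<^sup>+ w. epowr (iter (Suc j) w) q \<partial>\<sigma>) < \<infinity>"
      unfolding Lq_norm_def by (simp only: epowr_lt_top_iff)
  qed
qed

definition limit :: "'a \<times> real \<Rightarrow> ennreal" where
  "limit z = (SUP j. iter j z)"

lemma limit_measurable [measurable]: "limit \<in> borel_measurable \<sigma>"
  unfolding limit_def by measurable

lemma limit_tendsto: "z \<in> halfspace \<Longrightarrow> (\<lambda>j. iter j z) \<longlonglongrightarrow> limit z"
  unfolding limit_def by (intro LIMSEQ_SUP iter_incseq)

lemma limit_Lq: "(\<integral>\<^sup>+ w. epowr (limit w) q \<partial>\<sigma>) < \<infinity>"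
proof -
  have "(\<integral>\<^sup>+ w. epowr (limit w) q \<partial>\<sigma>) = (\<integral>\<^sup>+ w. (SUP j. epowr (iter j w) q) \<partial>\<sigma>)"
    unfolding limit_def using q by (simp add: epowr_SUP del: poisson_iter.simps)
  also have "\<dots> = (SUP j. \<integral>\<^sup>+ w. epowr (iter j w) q \<partial>\<sigma>)"
  proof (rule nn_integral_monotone_convergence_SUP_AE)
    show "AE w in \<sigma>. epowr (iter j w) q \<le> epowr (iter (Suc j) w) q" for j
      using q by (intro AE_I2 epowr_mono iter_le_Suc) (auto simp: space_eq)
  qed measurable
  also have "\<dots> \<le> ennreal (\<kappa> powr (q / (1 - q)))" by (intro SUP_least iter_Lq)
  finally show ?thesis by (rule order_le_less_trans) simp
qed

lemma limit_in_Lq: "in_Lq q \<sigma> limit"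
  unfolding in_Lq_def Lq_norm_def using limit_Lq by (simp only: epowr_lt_top_iff limit_measurable)

lemma limit_eq:
  assumes "z \<in> halfspace"
  shows "limit z = pp_op \<sigma> (\<lambda>w. epowr (limit w) q) z"
proof -
  have "pp_op \<sigma> (\<lambda>w. epowr (limit w) q) z = (\<integral>\<^sup>+ w. (SUP j. pp_kernel z w * epowr (iter j w) q) \<partial>\<sigma>)"
    unfolding limit_def pp_op_def using q by (simp add: epowr_SUP SUP_mult_left_ennreal del: poisson_iter.simps)
  also have "\<dots> = (SUP j. \<integral>\<^sup>+ w. pp_kernel z w * epowr (iter j w) q \<partial>\<sigma>)"
  proof (rule nn_integral_monotone_convergence_SUP_AE)
    show "AE w in \<sigma>. pp_kernel z w * epowr (iter j w) q \<le> pp_kernel z w * epowr (iter (Suc j) w) q" for j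
      using q by (intro AE_I2 mult_left_mono epowr_mono iter_le_Suc) (auto simp: space_eq)
  qed measurable
  also have "\<dots> = (SUP j. iter (Suc j) z)"
    unfolding iter_Suc pp_op_def ..
  also have "\<dots> = limit z"
    unfolding limit_def
  proof (rule antisym)
    show "(SUP j. iter (Suc j) z) \<le> (SUP j. iter j z)" by (intro SUP_least SUP_upper) simp
    show "(SUP j. iter j z) \<le> (SUP j. iter (Suc j) z)"
      by (intro SUP_mono') (rule iter_le_Suc[OF assms])
  qed
  finally show ?thesis ..
qed

lemma limit_solution:
  "z \<in> halfspace \<Longrightarrow> limit z = poisson_poisson_adj (power_measure q \<sigma> limit) z"
  unfolding power_measure_def by (subst poisson_poisson_adj_density) (simp_all add: limit_eq[symmetric])

text \<open>Integrability alone gives finiteness almost everywhere. The equation gives it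
  everywhere, because for fixed z the kernel is bounded.\<close>

lemma limit_finite:
  assumes "z \<in> halfspace"
  shows "limit z < \<infinity>"
proof -
  obtain C where
    bd: "\<And>z w :: 'a \<times> real. snd z > 0 \<Longrightarrow> snd w > 0 \<Longrightarrow> pp_kernel z w \<le> ennreal (C / snd z ^ DIM('a))"
    using pp_kernel_upper_bound[where 'a='a] by blast
  have "limit z \<le> (\<integral>\<^sup>+ w. ennreal (C / snd z ^ DIM('a)) * epowr (limit w) q \<partial>\<sigma>)"
    unfolding limit_eq[OF assms] pp_op_def
    by (intro nn_integral_mono mult_right_mono bd snd_pos) (use assms in \<open>auto simp: space_eq[symmetric] intro: snd_pos\<close>)
  also have "\<dots> = ennreal (C / snd z ^ DIM('a)) * (\<integral>\<^sup>+ w. epowr (limit w) q \<partial>\<sigma>)"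
    by (rule nn_integral_cmult) measurable
  also have "\<dots> < \<infinity>" using limit_Lq by (simp add: ennreal_mult_less_top)
  finally show ?thesis .
qed

lemma u0_le_limit: "ennreal c\<^sub>0 * epowr (poisson_poisson_adj \<sigma> z) (1 / (1 - q)) \<le> limit z"
  unfolding limit_def by (rule SUP_upper2[of 0]) auto

text \<open>The kernel is strictly positive, so the potential of a nonzero \<sigma> vanishes
  nowhere, and the limit lies above the first iterate.\<close>

lemma limit_pos:
  assumes "emeasure \<sigma> halfspace \<noteq> 0" "z \<in> halfspace"
  shows "limit z > 0"
proof -
  obtain k where k: "k > 0" and
    bd: "\<And>z w :: 'a \<times> real. snd z > 0 \<Longrightarrow> snd w > 0 \<Longrightarrow> ennreal k * ennreal (pp_cmp z w) \<le> pp_kernel z w"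
    using pp_kernel_bounds[where 'a='a] by blast
  have z: "snd z > 0" using assms(2) by (auto simp: halfspace_def)
  have pos: "pp_kernel z w > 0" if "w \<in> space \<sigma>" for w
    by (rule less_le_trans[OF _ bd[OF z snd_pos[OF that]]])
      (use k pp_cmp_pos[OF z snd_pos[OF that]] in \<open>simp add: ennreal_mult[symmetric]\<close>)
  have "pp_op \<sigma> (\<lambda>_. 1) z \<noteq> 0"
  proof
    assume "pp_op \<sigma> (\<lambda>_. 1) z = 0"
    hence "AE w in \<sigma>. pp_kernel z w * 1 = 0"
      unfolding pp_op_def by (subst (asm) nn_integral_0_iff_AE) auto
    moreover have "AE w in \<sigma>. pp_kernel z w \<noteq> 0"
      using pos by (intro AE_I2) (auto simp: less_le)
    ultimately have "AE w in \<sigma>. False" by eventually_elim simp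
    thus False using assms(1)
      by (simp add: trivial_limit_def[symmetric] ae_filter_eq_bot_iff space_eq)
  qed
  hence "ennreal c\<^sub>0 * epowr (pp_op \<sigma> (\<lambda>_. 1) z) (1 / (1 - q)) > 0"
    using c0 epowr_pos_iff[of "pp_op \<sigma> (\<lambda>_. 1) z" "1 / (1 - q)"]
    by (simp add: ennreal_zero_less_mult_iff zero_less_iff_neq_zero del: epowr_pos_iff)
  thus ?thesis using u0_le_limit[of z] by (simp add: poisson_poisson_adj_self)
qed

end

section \<open>The weak-type estimate\<close>

text \<open>The points are added by decreasing height; a new point receives the weight \<open>y^n\<close> if the potential
  of the earlier ones is still below 1 there, and 0 otherwise. Only strictly higher points enter the last bound,
  so that lower points added later do not spoil it.\<close>

lemma greedy_weights:
  fixes Z :: "('a::euclidean_space \<times> real) set"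
  assumes "finite Z" "\<And>z. z \<in> Z \<Longrightarrow> snd z > 0"
  shows "\<exists>a. (\<forall>z\<in>Z. 0 \<le> a z) \<and> (\<forall>z\<in>Z. 1 / 2 ^ DIM('a) \<le> (\<Sum>w\<in>Z. a w * pp_cmp z w)) \<and>
     (\<forall>t. (\<Sum>w\<in>Z. if w \<in> cone t then a w / snd w ^ DIM('a) else 0) \<le> 6 ^ (DIM('a) + 1) + 1) \<and>
     (\<forall>z\<in>Z. 0 < a z \<longrightarrow> (\<Sum>w\<in>Z. if snd w > snd z then a w * pp_cmp z w else 0) \<le> 1)"
  using assms
proof (induction rule: finite_ranking_induct[where f = "\<lambda>z. - snd z"])
  case (insert x S)
  let ?N = "DIM('a) + 1"
  show ?case
  proof (cases "x \<in> S")
    case True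
    thus ?thesis using insert by (simp add: insert_absorb)
  next
    case False
    have x: "snd x > 0" and S: "\<And>w. w \<in> S \<Longrightarrow> snd w > 0" "\<And>w. w \<in> S \<Longrightarrow> snd x \<le> snd w"
      using insert by auto
    obtain a where a0: "\<And>z. z \<in> S \<Longrightarrow> 0 \<le> a z"
      and lo: "\<And>z. z \<in> S \<Longrightarrow> 1 / 2 ^ DIM('a) \<le> (\<Sum>w\<in>S. a w * pp_cmp z w)"
      and co: "\<And>t. (\<Sum>w\<in>S. if w \<in> cone t then a w / snd w ^ DIM('a) else 0) \<le> 6 ^ ?N + 1"
      and up: "\<And>z. z \<in> S \<Longrightarrow> 0 < a z \<Longrightarrow> (\<Sum>w\<in>S. if snd w > snd z then a w * pp_cmp z w else 0) \<le> 1"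
      using insert.IH S(1) by blast
    define p where "p = (\<Sum>w\<in>S. a w * pp_cmp x w)"
    define b where "b = (if p \<ge> 1 then 0 else snd x ^ DIM('a))"
    have b0: "b \<ge> 0" using x by (simp add: b_def)
    define a' where "a' = a(x := b)"
    have sums: "(\<Sum>w\<in>insert x S. F (a' w) w) = F b x + (\<Sum>w\<in>S. F (a w) w)" for F :: "real \<Rightarrow> 'a \<times> real \<Rightarrow> real"
    proof -
      have "(\<Sum>w\<in>S. F (a' w) w) = (\<Sum>w\<in>S. F (a w) w)"
        using False by (intro sum.cong) (auto simp: a'_def)
      thus ?thesis using False \<open>finite S\<close> by (simp add: a'_def)
    qed
    have "1 / 2 ^ DIM('a) \<le> (\<Sum>w\<in>insert x S. a' w * pp_cmp z w)" if "z \<in> insert x S" for z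
    proof (cases "z = x")
      case True
      have p0: "p \<ge> 0" unfolding p_def using a0 S(1) pp_cmp_pos[OF x]
        by (intro sum_nonneg mult_nonneg_nonneg) (auto intro: less_imp_le)
      show ?thesis
      proof (cases "p \<ge> 1")
        case True
        hence "1 / 2 ^ DIM('a) \<le> p" by (rule order_trans[rotated]) simp
        thus ?thesis using True \<open>z = x\<close> unfolding sums[of "\<lambda>c w. c * pp_cmp z w"] by (simp add: b_def p_def)
      next
        case False
        \<comment> \<open>The contribution of a weighted point to its own potential; it fixes the
          lower bound \<open>1 / 2 ^ DIM('a)\<close>.\<close>
        have "snd x ^ DIM('a) * pp_cmp x x = snd x ^ DIM('a) * (2 * snd x / (2 * snd x) ^ ?N)"
          by (simp add: pp_cmp_def poisson_cmp_def)
        also have "\<dots> = 1 / 2 ^ DIM('a)" using x by (simp add: power_mult_distrib)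
        finally show ?thesis using False \<open>z = x\<close> p0
          unfolding sums[of "\<lambda>c w. c * pp_cmp z w"] by (simp add: b_def p_def)
      qed
    next
      case False
      hence z: "z \<in> S" using that by simp
      have "b * pp_cmp z x \<ge> 0" using b0 pp_cmp_pos[OF S(1)[OF z] x] by simp
      thus ?thesis using lo[OF z] unfolding sums[of "\<lambda>c w. c * pp_cmp z w"] by simp
    qed
    moreover have "(\<Sum>w\<in>insert x S. if w \<in> cone t then a' w / snd w ^ DIM('a) else 0) \<le> 6 ^ ?N + 1" for t
    proof (cases "x \<in> cone t \<and> p < 1")
      case True
      \<comment> \<open>If x receives weight, the earlier points have potential p < 1 at x. Those in
        the cone are at least as high as x, so their cone sum is at most \<open>6 ^ ?N * p\<close>;
        x itself adds exactly 1.\<close>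
      have "(\<Sum>w\<in>S. if w \<in> cone t then a w / snd w ^ DIM('a) else 0) \<le> (\<Sum>w\<in>S. 6 ^ ?N * (a w * pp_cmp x w))"
      proof (intro sum_mono)
        fix w assume w: "w \<in> S"
        have "a w * (1 / snd w ^ DIM('a)) \<le> a w * (6 ^ ?N * pp_cmp x w)" if "w \<in> cone t"
          using True that S[OF w] x a0[OF w] by (intro mult_left_mono cone_pp_cmp[of x t w]) auto
        moreover have "0 \<le> 6 ^ ?N * (a w * pp_cmp x w)"
          using a0[OF w] pp_cmp_pos[OF x S(1)[OF w]] by simp
        ultimately show "(if w \<in> cone t then a w / snd w ^ DIM('a) else 0) \<le> 6 ^ ?N * (a w * pp_cmp x w)"
          by (simp add: mult_ac del: power_Suc)
      qed
      also have "\<dots> = 6 ^ ?N * p" by (simp add: p_def sum_distrib_left)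
      also have "\<dots> \<le> 6 ^ ?N * 1" using True by (intro mult_left_mono) auto
      finally show ?thesis using True x
        unfolding sums[of "\<lambda>c w. if w \<in> cone t then c / snd w ^ DIM('a) else 0"] by (simp add: b_def)
    next
      case False
      thus ?thesis using co[of t]
        unfolding sums[of "\<lambda>c w. if w \<in> cone t then c / snd w ^ DIM('a) else 0"] by (auto simp: b_def)
    qed
    moreover have "(\<Sum>w\<in>insert x S. if snd w > snd z then a' w * pp_cmp z w else 0) \<le> 1"
      if z: "z \<in> insert x S" and az: "0 < a' z" for z
    proof (cases "z = x")
      case True
      have p1: "p < 1" using az True by (auto simp: a'_def b_def split: if_splits)
      have "(\<Sum>w\<in>S. if snd w > snd x then a w * pp_cmp x w else 0) \<le> p"
        unfolding p_def using a0 S(1) pp_cmp_pos[OF x]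
        by (intro sum_mono) (auto intro!: mult_nonneg_nonneg less_imp_le[OF pp_cmp_pos] x)
      with p1 have "(\<Sum>w\<in>S. if snd w > snd x then a w * pp_cmp x w else 0) \<le> 1" by simp
      thus ?thesis unfolding True
        unfolding sums[of "\<lambda>c w. if snd w > snd x then c * pp_cmp x w else 0"] by simp
    next
      case False
      hence zS: "z \<in> S" using z by simp
      have "a z > 0" using az False by (simp add: a'_def)
      thus ?thesis using up[OF zS] S(2)[OF zS]
        unfolding sums[of "\<lambda>c w. if snd w > snd z then c * pp_cmp z w else 0"] by simp
    qed
    moreover have "\<forall>z\<in>insert x S. 0 \<le> a' z" using a0 b0 by (auto simp: a'_def)
    ultimately show ?thesis by blast
  qed
qed auto

text \<open>The cone bound and the bound on higher mass in \<open>greedy_weights\<close> are the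
  hypotheses of \<open>potential_bound\<close> for the discrete measure. The resulting bound holds
  at every height; just above a boundary point t it controls the adjoint potential at t.\<close>

lemma equilibrium_weights:
  "\<exists>C>0. \<forall>Z :: ('a::euclidean_space \<times> real) set. finite Z \<longrightarrow> (\<forall>z\<in>Z. snd z > 0) \<longrightarrow>
    (\<exists>a. (\<forall>z\<in>Z. 0 \<le> a z) \<and> (\<forall>z\<in>Z. 1 / 2 ^ DIM('a) \<le> (\<Sum>w\<in>Z. a w * pp_cmp z w)) \<and>
      (\<forall>t. (\<Sum>w\<in>Z. a w * poisson_kernel (fst w - t) (snd w)) \<le> C))"
proof -
  let ?N = "DIM('a) + 1" and ?c = "poisson_const TYPE('a)"
  define C0 where "C0 = (cone_const TYPE('a) + 3 ^ ?N * (cone_const TYPE('a) + 1)) * (6 ^ ?N + 1)"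
  define C where "C = ?c * 2 ^ ?N * (2 ^ ?N * C0)"
  have c: "?c > 0" by (rule poisson_const_pos)
  have C0: "C0 > 0" unfolding C0_def using cone_const_pos[where 'a='a]
    by (intro mult_pos_pos add_pos_pos) auto
  have C: "C > 0" unfolding C_def using c C0 by simp
  have "\<exists>a. (\<forall>z\<in>Z. 0 \<le> a z) \<and> (\<forall>z\<in>Z. 1 / 2 ^ DIM('a) \<le> (\<Sum>w\<in>Z. a w * pp_cmp z w)) \<and>
      (\<forall>t. (\<Sum>w\<in>Z. a w * poisson_kernel (fst w - t) (snd w)) \<le> C)"
    if fin: "finite Z" and Z: "\<forall>z\<in>Z. snd z > 0" for Z :: "('a \<times> real) set"
  proof -
    obtain a where a0: "\<And>z. z \<in> Z \<Longrightarrow> 0 \<le> a z"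
      and lo: "\<And>z. z \<in> Z \<Longrightarrow> 1 / 2 ^ DIM('a) \<le> (\<Sum>w\<in>Z. a w * pp_cmp z w)"
      and co: "\<And>t. (\<Sum>w\<in>Z. if w \<in> cone t then a w / snd w ^ DIM('a) else 0) \<le> 6 ^ ?N + 1"
      and up: "\<And>z. z \<in> Z \<Longrightarrow> 0 < a z \<Longrightarrow> (\<Sum>w\<in>Z. if snd w > snd z then a w * pp_cmp z w else 0) \<le> 1"
      using greedy_weights[OF fin bspec[OF Z]] by blast
    define M where "M = point_measure Z (\<lambda>w. ennreal (a w))"
    have int: "(\<integral>\<^sup>+ w. F w \<partial>M) = (\<Sum>w\<in>Z. ennreal (a w) * F w)" for F
      unfolding M_def by (rule nn_integral_point_measure_finite[OF fin])
    interpret M: halfspace_measure M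
    proof -
      interpret finite_measure M
        unfolding M_def using fin
        by (intro finite_measureI) (simp add: space_point_measure emeasure_point_measure_finite)
      have "fst \<in> borel_measurable M" "snd \<in> borel_measurable M"
        by (auto simp: M_def measurable_point_measure_eq1)
      thus "halfspace_measure M"
        using Z by unfold_locales (auto simp: M_def space_point_measure)
    qed
    have pot: "M.potential z = ennreal (\<Sum>w\<in>Z. a w * pp_cmp z w)" if "snd z > 0" for z
      unfolding M.potential_def int
      by (subst sum_ennreal[symmetric])
        (use a0 Z that pp_cmp_pos[of z] in \<open>auto simp: ennreal_mult mult.commute less_imp_le intro!: sum.cong\<close>)
    have bound: "(\<Sum>w\<in>Z. a w * pp_cmp z w) \<le> C0" if z: "snd z > 0" for z
    proof -
      have "M.potential z \<le> ennreal (cone_const TYPE('a) + 3 ^ ?N * (cone_const TYPE('a) + 1)) * ennreal (6 ^ ?N + 1)"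
      proof (rule M.potential_bound[OF _ _ _ _ z])
        \<comment> \<open>The carrier omits points of weight 0, where the potential of the higher
          points is not known to be at most 1.\<close>
        show "AE w in M. w \<in> {w \<in> Z. a w > 0}"
          unfolding M_def using fin a0
          by (subst AE_point_measure) auto
        show "snd w > 0" if "w \<in> {w \<in> Z. a w > 0}" for w using that Z by auto
        show "M.cone_mass t \<le> ennreal (6 ^ ?N + 1)" for t
        proof -
          have "M.cone_mass t = ennreal (\<Sum>w\<in>Z. if w \<in> cone t then a w / snd w ^ DIM('a) else 0)"
          proof -
            have "M.cone_mass t = (\<Sum>w\<in>Z. ennreal (if w \<in> cone t then a w / snd w ^ DIM('a) else 0))"
              unfolding M.cone_mass_def int
            proof (intro sum.cong refl)
              fix w assume "w \<in> Z"
              thus "ennreal (a w) * (indicator (cone t) w * ennreal (1 / snd w ^ DIM('a)))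
                  = ennreal (if w \<in> cone t then a w / snd w ^ DIM('a) else 0)"
                using a0 Z by (simp add: ennreal_mult[symmetric] less_imp_le)
            qed
            also have "\<dots> = ennreal (\<Sum>w\<in>Z. if w \<in> cone t then a w / snd w ^ DIM('a) else 0)"
              using a0 Z by (intro sum_ennreal) (auto simp: less_imp_le)
            finally show ?thesis .
          qed
          thus ?thesis using ennreal_leI[OF co[of t]] by simp
        qed
        show "(\<integral>\<^sup>+ w. indicator {w. snd w > snd z} w * ennreal (pp_cmp z w) \<partial>M) \<le> ennreal (6 ^ ?N + 1)"
          if z: "z \<in> {w \<in> Z. a w > 0}" for z
        proof -
          have "(\<integral>\<^sup>+ w. indicator {w. snd w > snd z} w * ennreal (pp_cmp z w) \<partial>M)
              = ennreal (\<Sum>w\<in>Z. if snd w > snd z then a w * pp_cmp z w else 0)"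
          proof -
            have "(\<integral>\<^sup>+ w. indicator {w. snd w > snd z} w * ennreal (pp_cmp z w) \<partial>M)
                = (\<Sum>w\<in>Z. ennreal (if snd w > snd z then a w * pp_cmp z w else 0))"
              unfolding int
            proof (intro sum.cong refl)
              fix w assume "w \<in> Z"
              thus "ennreal (a w) * (indicator {w. snd w > snd z} w * ennreal (pp_cmp z w))
                  = ennreal (if snd w > snd z then a w * pp_cmp z w else 0)"
                using a0 Z z pp_cmp_pos[of z w] by (simp add: ennreal_mult less_imp_le)
            qed
            also have "\<dots> = ennreal (\<Sum>w\<in>Z. if snd w > snd z then a w * pp_cmp z w else 0)"
              using a0 Z z by (intro sum_ennreal) (auto simp: less_imp_le pp_cmp_pos)
            finally show ?thesis .
          qed
          also have "\<dots> \<le> ennreal 1" using up z by (intro ennreal_leI) auto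
          also have "\<dots> \<le> ennreal (6 ^ ?N + 1)" by (intro ennreal_leI) simp
          finally show ?thesis .
        qed
      qed
      also have "\<dots> = ennreal C0"
        unfolding C0_def using cone_const_pos[where 'a='a] by (intro ennreal_mult[symmetric]) auto
      finally show ?thesis using pot[OF z] C0 by (simp add: ennreal_le_iff)
    qed
    have "(\<Sum>w\<in>Z. a w * poisson_kernel (fst w - t) (snd w)) \<le> C" for t
    proof -
      \<comment> \<open>A height no larger than any height in Z, so that adding it at most doubles
        the denominator base; the entry 1 covers empty Z.\<close>
      define y where "y = Min (insert 1 (snd ` Z))"
      have y: "y > 0" "\<And>w. w \<in> Z \<Longrightarrow> y \<le> snd w"
        unfolding y_def using fin Z by (auto simp: Min_gr_iff)
      have "(\<Sum>w\<in>Z. a w * poisson_kernel (fst w - t) (snd w)) \<le> (\<Sum>w\<in>Z. ?c * 2 ^ ?N * (2 ^ ?N * (a w * pp_cmp (t, y) w)))"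
      proof (intro sum_mono)
        fix w assume w: "w \<in> Z"
        have "poisson_cmp (fst w - t) (snd w) \<le> 1 * 2 ^ ?N * poisson_cmp (t - fst w) (y + snd w)"
          using y(1) y(2)[OF w] w Z norm_ge_zero[of "t - fst w"]
          by (intro poisson_cmp_le_poisson_cmp) (auto simp: norm_minus_commute simp del: norm_ge_zero)
        hence "?c * 2 ^ ?N * poisson_cmp (fst w - t) (snd w) \<le> ?c * 2 ^ ?N * (2 ^ ?N * pp_cmp (t, y) w)"
          using c by (intro mult_left_mono) (auto simp: pp_cmp_def)
        hence "poisson_kernel (fst w - t) (snd w) \<le> ?c * 2 ^ ?N * (2 ^ ?N * pp_cmp (t, y) w)"
          using poisson_kernel_bounds(2)[of "snd w" "fst w - t"] w Z by (meson order_trans)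
        from mult_left_mono[OF this a0[OF w]]
        show "a w * poisson_kernel (fst w - t) (snd w) \<le> ?c * 2 ^ ?N * (2 ^ ?N * (a w * pp_cmp (t, y) w))"
          by (simp add: mult_ac del: power_Suc)
      qed
      also have "\<dots> = ?c * 2 ^ ?N * (2 ^ ?N * (\<Sum>w\<in>Z. a w * pp_cmp (t, y) w))"
        by (simp only: sum_distrib_left)
      also have "\<dots> \<le> C" unfolding C_def using c y bound[of "(t, y)"]
        by (intro mult_left_mono) auto
      finally show ?thesis .
    qed
    thus ?thesis using a0 lo by blast
  qed
  thus ?thesis using C by blast
qed


text \<open>The centres must belong to S itself, where the inequalities to be used hold. S need not
  be closed, so compactness is applied to its closure.\<close>

lemma finite_net:
  fixes S :: "'m::metric_space set"
  assumes "S \<subseteq> K" "compact K" "e > 0"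
  obtains Z where "finite Z" "Z \<subseteq> S" "\<And>z. z \<in> S \<Longrightarrow> \<exists>w\<in>Z. dist w z < e"
proof -
  have "closure S \<subseteq> K" using assms(1,2) by (simp add: closure_minimal compact_imp_closed)
  hence c: "compact (closure S)" using compact_Int_closed[OF assms(2), of "closure S"] by (simp add: Int_absorb1)
  have cov: "closure S \<subseteq> (\<Union>w\<in>S. ball w e)"
  proof
    fix z assume "z \<in> closure S"
    then obtain w where "w \<in> S" "dist w z < e" using assms(3) by (auto simp: closure_approachable)
    thus "z \<in> (\<Union>w\<in>S. ball w e)" by auto
  qed
  obtain Z where Z: "Z \<subseteq> S" "finite Z" "closure S \<subseteq> (\<Union>w\<in>Z. ball w e)"
    using compactE_image[OF c open_ball cov] by metis
  show ?thesis
  proof (rule that[OF Z(2,1)])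
    fix z assume "z \<in> S"
    hence "z \<in> (\<Union>w\<in>Z. ball w e)" using Z(3) closure_subset by blast
    thus "\<exists>w\<in>Z. dist w z < e" by auto
  qed
qed

text \<open>A displacement of at most half the height of w changes the height sum, and the sum of
  norm and heights, by at most a factor 2 each.\<close>

lemma pp_cmp_Harnack:
  assumes "snd w > 0" "snd v > 0" "snd z > 0" "dist w z \<le> e" "2 * e \<le> snd w"
  shows "pp_cmp w v \<le> 2 * 2 ^ (DIM('a) + 1) * pp_cmp z (v :: 'a::euclidean_space \<times> real)"
proof -
  have "norm (fst z - fst w) \<le> e" "\<bar>snd w - snd z\<bar> \<le> e"
    using order_trans[OF dist_fst_le assms(4)] order_trans[OF dist_snd_le assms(4)]
    by (auto simp: dist_norm norm_minus_commute)
  moreover have "norm (fst z - fst v) \<le> norm (fst z - fst w) + norm (fst w - fst v)"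
    using norm_triangle_ineq[of "fst z - fst w" "fst w - fst v"] by simp
  ultimately show ?thesis
    unfolding pp_cmp_def using assms norm_ge_zero[of "fst w - fst v"]
    by (intro poisson_cmp_le_poisson_cmp) (auto simp: abs_le_iff simp del: norm_ge_zero)
qed

lemma poisson_le:
  assumes "snd z > 0"
  shows "poisson \<nu> z \<le> ennreal (poisson_const TYPE('a) * 2 ^ (DIM('a) + 1) * (1 / snd z ^ DIM('a)))
    * emeasure \<nu> (space (\<nu> :: 'a::euclidean_space measure))" (is "_ \<le> ennreal ?B * _")
proof -
  have "poisson_kernel (fst z - t) (snd z) \<le> ?B" for t
    using poisson_kernel_bounds(2)[OF assms, of "fst z - t"] poisson_const_pos[where 'a='a]
      mult_left_mono[OF poisson_cmp_le[OF assms, of "fst z - t"], of "poisson_const TYPE('a) * 2 ^ (DIM('a) + 1)"]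
    by (simp del: power_Suc)
  hence "poisson \<nu> z \<le> (\<integral>\<^sup>+ t. ennreal ?B \<partial>\<nu>)"
    unfolding poisson_def case_prod_beta' by (intro nn_integral_mono ennreal_leI)
  thus ?thesis by simp
qed

lemma (in halfspace_measure) poisson_measurable:
  assumes "finite_measure \<nu>" and s: "sets \<nu> = sets borel"
  shows "poisson \<nu> \<in> borel_measurable M"
proof -
  interpret \<nu>: finite_measure \<nu> by (rule assms(1))
  note [measurable_cong] = s
  have "(\<lambda>(z, t). ennreal (poisson_kernel (fst z - t) (snd z))) \<in> borel_measurable (M \<Otimes>\<^sub>M \<nu>)"
    by measurable
  from \<nu>.borel_measurable_nn_integral[OF this] show ?thesis
    by (simp add: poisson_def case_prod_beta')
qed

text \<open>A duality argument: the potential of \<eta> is bounded below on the set in question, so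
  the integral of f there is at most a multiple of the pairing of \<eta> with
  \<open>pp_op \<sigma> f\<close>, hence with u. On the atoms l u is below \<open>P\<nu>\<close>,
  and pairing \<eta> with \<open>P\<nu>\<close> costs only the supremum of
  \<open>P*\<eta>\<close>.\<close>

lemma weak_type_estimate:
  "\<exists>C>0. \<forall>\<sigma> \<in> locally_finite_borel_measures (halfspace :: ('a::euclidean_space \<times> real) set).
    \<forall>u f \<nu> l. u \<in> borel_measurable \<sigma> \<longrightarrow> f \<in> borel_measurable \<sigma> \<longrightarrow>
      (\<forall>z\<in>halfspace. pp_op \<sigma> f z \<le> u z) \<longrightarrow> finite_measure \<nu> \<longrightarrow> sets \<nu> = sets borel \<longrightarrow>
      l * (\<integral>\<^sup>+ z. indicator {z \<in> halfspace. l * u z < poisson \<nu> z} z * f z \<partial>\<sigma>) \<le> ennreal C * emeasure \<nu> UNIV"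
proof -
  let ?N = "DIM('a) + 1"
  obtain c where c: "c > 0" and
    bd: "\<And>z w :: 'a \<times> real. snd z > 0 \<Longrightarrow> snd w > 0 \<Longrightarrow> ennreal c * ennreal (pp_cmp z w) \<le> pp_kernel z w"
    using pp_kernel_bounds[where 'a='a] by blast
  obtain B where B: "B > 0" and eq: "\<And>Z :: ('a \<times> real) set. finite Z \<Longrightarrow> (\<forall>z\<in>Z. snd z > 0) \<Longrightarrow>
    (\<exists>a. (\<forall>z\<in>Z. 0 \<le> a z) \<and> (\<forall>z\<in>Z. 1 / 2 ^ DIM('a) \<le> (\<Sum>w\<in>Z. a w * pp_cmp z w)) \<and>
      (\<forall>t. (\<Sum>w\<in>Z. a w * poisson_kernel (fst w - t) (snd w)) \<le> B))"
    using equilibrium_weights[where 'a='a] by blast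
  \<comment> \<open>The reciprocal of the lower bound for the potential on the net, times the
    Harnack factor, divided by the lower kernel constant.\<close>
  define D where "D = 2 ^ DIM('a) * (2 * 2 ^ ?N) / c"
  have D: "D > 0" using c by (simp add: D_def)
  have "l * (\<integral>\<^sup>+ z. indicator {z \<in> halfspace. l * u z < poisson \<nu> z} z * f z \<partial>\<sigma>) \<le> ennreal (D * B) * emeasure \<nu> UNIV"
    if \<sigma>: "\<sigma> \<in> locally_finite_borel_measures (halfspace :: ('a \<times> real) set)"
      and u [measurable]: "u \<in> borel_measurable \<sigma>" and f [measurable]: "f \<in> borel_measurable \<sigma>"
      and sup: "\<forall>z\<in>halfspace. pp_op \<sigma> f z \<le> u z"
      and \<nu>: "finite_measure \<nu>" "sets \<nu> = sets borel"
    for \<sigma> u f \<nu> l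
  proof -
    interpret halfspace_measure \<sigma> by (rule halfspace_measure_locally_finite[OF \<sigma>])
    note sp = locally_finite_space[OF \<sigma>]
    note [measurable] = exhaustion_in_sets[OF \<sigma>] poisson_measurable[OF \<nu>]
    define E where "E = {z \<in> halfspace. l * u z < poisson \<nu> z}"
    have [measurable]: "E \<in> sets \<sigma>" unfolding E_def sp[symmetric] by measurable
    have main: "l * (\<integral>\<^sup>+ z. indicator (E \<inter> exhaustion k) z * f z \<partial>\<sigma>) \<le> ennreal (D * B) * emeasure \<nu> UNIV" for k
    proof -
      \<comment> \<open>Half the least height in \<open>exhaustion k\<close>, as
        \<open>pp_cmp_Harnack\<close> requires.\<close>
      define e where "e = 1 / (2 * real (Suc k))"
      have e: "e > 0" by (simp add: e_def)
      obtain Z where Z: "finite Z" "Z \<subseteq> E \<inter> exhaustion k"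
        "\<And>z. z \<in> E \<inter> exhaustion k \<Longrightarrow> \<exists>w\<in>Z. dist w z < e"
        by (rule finite_net[OF Int_lower2 compact_exhaustion e, of E k]) blast
      have Zs: "snd w > 0" "2 * e \<le> snd w" if "w \<in> Z" for w
        using Z(2) that exhaustion_snd[of w k] by (auto simp: e_def simp del: of_nat_Suc)
      have ZE: "l * u w \<le> poisson \<nu> w" "pp_op \<sigma> f w \<le> u w" if "w \<in> Z" for w
        using Z(2) that sup by (auto simp: E_def less_imp_le)
      obtain a where a0: "\<And>z. z \<in> Z \<Longrightarrow> 0 \<le> a z"
        and lo: "\<And>z. z \<in> Z \<Longrightarrow> 1 / 2 ^ DIM('a) \<le> (\<Sum>w\<in>Z. a w * pp_cmp z w)"
        and up: "\<And>t. (\<Sum>w\<in>Z. a w * poisson_kernel (fst w - t) (snd w)) \<le> B"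
        using eq[OF Z(1)] Zs(1) by blast
      \<comment> \<open>Harnack carries the lower bound for the potential of \<eta> from the net to
        the whole set, so the indicator is at most D times that potential.\<close>
      have pt: "indicator (E \<inter> exhaustion k) z * f z \<le> ennreal D * (\<Sum>w\<in>Z. ennreal (a w) * (pp_kernel w z * f z))"
        if zs: "z \<in> space \<sigma>" for z
      proof (cases "z \<in> E \<inter> exhaustion k")
        case True
        obtain z' where z': "z' \<in> Z" "dist z' z < e" using Z(3)[OF True] by blast
        have "1 / 2 ^ DIM('a) \<le> (\<Sum>w\<in>Z. a w * pp_cmp z' w)" by (rule lo[OF z'(1)])
        also have "\<dots> \<le> (\<Sum>w\<in>Z. a w * (2 * 2 ^ ?N * pp_cmp z w))"
          using z' Zs by (intro sum_mono mult_left_mono pp_cmp_Harnack[where e=e] a0) (auto intro: snd_pos[OF zs])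
        also have "\<dots> = 2 * 2 ^ ?N * (\<Sum>w\<in>Z. a w * pp_cmp z w)"
          by (simp add: sum_distrib_left mult_ac del: power_Suc)
        finally have "1 \<le> 2 ^ DIM('a) * (2 * 2 ^ ?N * (\<Sum>w\<in>Z. a w * pp_cmp z w))"
          by (simp add: divide_le_eq mult.commute del: power_Suc)
        also have "\<dots> = D * (\<Sum>w\<in>Z. a w * (c * pp_cmp w z))"
        proof -
          have "(\<Sum>w\<in>Z. a w * (c * pp_cmp w z)) = c * (\<Sum>w\<in>Z. a w * pp_cmp z w)"
            by (simp add: sum_distrib_left mult_ac pp_cmp_sym[of z])
          thus ?thesis using c by (simp add: D_def)
        qed
        finally have "1 \<le> ennreal (D * (\<Sum>w\<in>Z. a w * (c * pp_cmp w z)))" by simp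
        also have "\<dots> = ennreal D * (\<Sum>w\<in>Z. ennreal (a w * (c * pp_cmp w z)))"
        proof -
          have nn: "0 \<le> a w * (c * pp_cmp w z)" if "w \<in> Z" for w
            using a0[OF that] c pp_cmp_pos[OF Zs(1)[OF that] snd_pos[OF zs]] by simp
          show ?thesis using D nn by (subst sum_ennreal) (auto simp: ennreal_mult sum_nonneg)
        qed
        also have "\<dots> \<le> ennreal D * (\<Sum>w\<in>Z. ennreal (a w) * pp_kernel w z)"
        proof (intro mult_left_mono sum_mono)
          fix w assume w: "w \<in> Z"
          have "ennreal (a w * (c * pp_cmp w z)) = ennreal (a w) * (ennreal c * ennreal (pp_cmp w z))"
            using a0[OF w] c pp_cmp_pos[OF Zs(1)[OF w] snd_pos[OF zs]] by (simp add: ennreal_mult[symmetric])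
          also have "\<dots> \<le> ennreal (a w) * pp_kernel w z"
            by (intro mult_left_mono bd Zs(1)[OF w] snd_pos[OF zs]) simp
          finally show "ennreal (a w * (c * pp_cmp w z)) \<le> ennreal (a w) * pp_kernel w z" .
        qed simp
        finally have "1 * f z \<le> (ennreal D * (\<Sum>w\<in>Z. ennreal (a w) * pp_kernel w z)) * f z"
          by (rule mult_right_mono) simp
        thus ?thesis using True by (simp add: sum_distrib_right mult.assoc)
      qed simp
      have "(\<integral>\<^sup>+ z. indicator (E \<inter> exhaustion k) z * f z \<partial>\<sigma>)
          \<le> (\<integral>\<^sup>+ z. ennreal D * (\<Sum>w\<in>Z. ennreal (a w) * (pp_kernel w z * f z)) \<partial>\<sigma>)"
        by (intro nn_integral_mono pt)
      also have "\<dots> = ennreal D * (\<Sum>w\<in>Z. ennreal (a w) * pp_op \<sigma> f w)"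
        unfolding pp_op_def by (simp add: nn_integral_cmult nn_integral_sum)
      also have "\<dots> \<le> ennreal D * (\<Sum>w\<in>Z. ennreal (a w) * u w)"
        by (intro mult_left_mono sum_mono ZE) auto
      finally have "l * (\<integral>\<^sup>+ z. indicator (E \<inter> exhaustion k) z * f z \<partial>\<sigma>)
          \<le> l * (ennreal D * (\<Sum>w\<in>Z. ennreal (a w) * u w))" by (rule mult_left_mono) simp
      also have "\<dots> = ennreal D * (\<Sum>w\<in>Z. ennreal (a w) * (l * u w))"
        by (simp add: sum_distrib_left mult_ac)
      also have "\<dots> \<le> ennreal D * (\<Sum>w\<in>Z. ennreal (a w) * poisson \<nu> w)"
        by (intro mult_left_mono sum_mono ZE) auto
      \<comment> \<open>Pairing \<eta> with \<open>P\<nu>\<close> is integrating the bounded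
        function \<open>P*\<eta>\<close> against \<nu>.\<close>
      also have "(\<Sum>w\<in>Z. ennreal (a w) * poisson \<nu> w) = (\<integral>\<^sup>+ t. (\<Sum>w\<in>Z. ennreal (a w) * ennreal (poisson_kernel (fst w - t) (snd w))) \<partial>\<nu>)"
      proof -
        note [measurable_cong] = \<nu>(2)
        show ?thesis unfolding poisson_def case_prod_beta'
          by (subst nn_integral_sum) (auto simp: nn_integral_cmult)
      qed
      also have "\<dots> \<le> (\<integral>\<^sup>+ t. ennreal B \<partial>\<nu>)"
      proof (intro nn_integral_mono)
        fix t
        have "(\<Sum>w\<in>Z. ennreal (a w) * ennreal (poisson_kernel (fst w - t) (snd w)))
            = ennreal (\<Sum>w\<in>Z. a w * poisson_kernel (fst w - t) (snd w))"
          using a0 Zs(1) by (subst sum_ennreal[symmetric])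
            (auto simp: ennreal_mult less_imp_le poisson_kernel_pos)
        also have "\<dots> \<le> ennreal B" by (intro ennreal_leI up)
        finally show "(\<Sum>w\<in>Z. ennreal (a w) * ennreal (poisson_kernel (fst w - t) (snd w))) \<le> ennreal B" .
      qed
      also have "\<dots> = ennreal B * emeasure \<nu> UNIV"
        using sets_eq_imp_space_eq[OF \<nu>(2)] by simp
      finally show ?thesis using D B by (simp add: ennreal_mult mult.assoc mult_left_mono)
    qed
    have "(\<integral>\<^sup>+ z. indicator E z * f z \<partial>\<sigma>) = (\<integral>\<^sup>+ z. (SUP k. indicator (E \<inter> exhaustion k) z * f z) \<partial>\<sigma>)"
    proof (intro nn_integral_cong antisym)
      fix z assume "z \<in> space \<sigma>"
      then obtain k where "z \<in> exhaustion k" using exhaustion_covers sp by metis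
      hence "indicator E z * f z = indicator (E \<inter> exhaustion k) z * f z" by (simp add: indicator_def)
      thus "indicator E z * f z \<le> (SUP k. indicator (E \<inter> exhaustion k) z * f z)"
        by (rule order_trans[OF eq_refl SUP_upper[OF UNIV_I]])
      show "(SUP k. indicator (E \<inter> exhaustion k) z * f z) \<le> indicator E z * f z"
        by (intro SUP_least mult_right_mono) (auto simp: indicator_def)
    qed
    also have "\<dots> = (SUP k. \<integral>\<^sup>+ z. indicator (E \<inter> exhaustion k) z * f z \<partial>\<sigma>)"
    proof (intro nn_integral_monotone_convergence_SUP monoI le_funI mult_right_mono)
      fix i j :: nat and z :: "'a \<times> real" assume "i \<le> j"
      from exhaustion_mono[OF this, where 'a='a]
      show "indicator (E \<inter> exhaustion i) z \<le> (indicator (E \<inter> exhaustion j) z :: ennreal)"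
        by (auto simp: indicator_def)
    qed auto
    finally have "l * (\<integral>\<^sup>+ z. indicator E z * f z \<partial>\<sigma>) = (SUP k. l * (\<integral>\<^sup>+ z. indicator (E \<inter> exhaustion k) z * f z \<partial>\<sigma>))"
      by (simp add: SUP_mult_left_ennreal)
    also have "\<dots> \<le> ennreal (D * B) * emeasure \<nu> UNIV" by (intro SUP_least main)
    finally show ?thesis unfolding E_def .
  qed
  moreover have "D * B > 0" using D B by simp
  ultimately show ?thesis by blast
qed

section \<open>Supersolutions and the trace inequality\<close>

lemma dyadic_level:
  fixes p b :: real
  assumes "b > 0" "b < p"
  obtains k where "2 ^ k * b < p" "p \<le> 2 ^ Suc k * b"
proof -
  obtain j :: nat where "p / b < 2 ^ j" using real_arch_pow[of 2 "p / b"] by auto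
  hence j: "p \<le> 2 ^ j * b" using assms by (simp add: field_simps)
  define i where "i = (LEAST i. p \<le> 2 ^ i * b)"
  have i: "p \<le> 2 ^ i * b" unfolding i_def using j by (rule LeastI)
  hence "i \<noteq> 0" using assms by (cases i) auto
  then obtain k where k: "i = Suc k" by (cases i) auto
  hence "\<not> p \<le> 2 ^ k * b" using not_less_Least[of k "\<lambda>i. p \<le> 2 ^ i * b"] by (simp add: i_def)
  thus ?thesis using i unfolding k by (intro that[of k]) simp_all
qed

text \<open>A dyadic layer decomposition by the size of p/(m u). Either p \<le> m u, or the single
  layer with 2^k m u < p \<le> 2^(k+1) m u already bounds the left side; the other terms are
  nonnegative.\<close>

lemma epowr_le_dyadic_sum:
  assumes q: "0 < q" and m: "m > 0" and u: "0 < u" "u < \<infinity>" and p: "p < \<infinity>"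
  shows "epowr p q \<le> ennreal (m powr q) * epowr u q +
    (\<Sum>k. ennreal ((2 ^ Suc k * m) powr q) * (if ennreal (2 ^ k * m) * u < p then epowr u q else 0))"
proof -
  obtain r where r: "p = ennreal r" "r \<ge> 0" using p by (cases p) auto
  obtain v where v: "u = ennreal v" "v > 0" using u by (cases u) (auto simp: ennreal_less_zero_iff)
  let ?F = "\<lambda>k. ennreal ((2 ^ Suc k * m) powr q) * (if ennreal (2 ^ k * m) * u < p then epowr u q else 0)"
  have le: "epowr p q \<le> ennreal (b powr q) * epowr u q" if "r \<le> b * v" "b > 0" for b
  proof -
    have "p \<le> ennreal b * u" using that r v by (simp add: ennreal_mult[symmetric] ennreal_leI)
    from epowr_mono[OF q this] show ?thesis using that by (simp add: epowr_cmult)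
  qed
  show ?thesis
  proof (cases "r \<le> m * v")
    case True
    from le[OF this m] show ?thesis by (rule order_trans) simp
  next
    case False
    then obtain k where k: "2 ^ k * (m * v) < r" "r \<le> 2 ^ Suc k * (m * v)"
      using dyadic_level[of "m * v" r] m v by auto
    have "epowr p q \<le> ennreal ((2 ^ Suc k * m) powr q) * epowr u q"
      using k m by (intro le) (auto simp: mult_ac)
    also have "\<dots> = ?F k"
    proof -
      have "ennreal (2 ^ k * m) * u < p"
        using k m v r by (simp add: ennreal_mult[symmetric] ennreal_less_iff mult.assoc)
      thus ?thesis by simp
    qed
    also have "\<dots> \<le> (\<Sum>k. ?F k)"
      using sum_le_suminf[of ?F "{k}"] by simp
    finally show ?thesis by (rule order_trans) simp
  qed
qed

text \<open>The levels are the multiples 2^k m of the total mass m of \<nu>, for which the weak-type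
  bound is C/2^k, free of m. The layers then sum to m^q times a constant; the bottom layer is paid
  for by the finite integral of u^q.\<close>

lemma supersolution_imp_trace_ineq:
  assumes q: "0 < q" "q < 1"
    and \<sigma>: "\<sigma> \<in> locally_finite_borel_measures (halfspace :: ('a::euclidean_space \<times> real) set)"
    and u_meas: "u \<in> borel_measurable \<sigma>"
    and u: "\<forall>z\<in>halfspace. 0 < u z \<and> u z < \<infinity>"
    and fin: "(\<integral>\<^sup>+ z. epowr (u z) q \<partial>\<sigma>) < \<infinity>"
    and sup: "\<forall>z\<in>halfspace. pp_op \<sigma> (\<lambda>w. epowr (u w) q) z \<le> u z"
  shows "\<exists>\<kappa>>0. poisson_trace_ineq q \<sigma> \<kappa>"
proof -
  interpret halfspace_measure \<sigma> by (rule halfspace_measure_locally_finite[OF \<sigma>])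
  note sp = locally_finite_space[OF \<sigma>]
  note [measurable] = u_meas
  obtain C where C: "C > 0" and wt: "\<And>\<nu> l. finite_measure \<nu> \<Longrightarrow> sets \<nu> = sets borel \<Longrightarrow>
      l * (\<integral>\<^sup>+ z. indicator {z \<in> halfspace. l * u z < poisson \<nu> z} z * epowr (u z) q \<partial>\<sigma>) \<le> ennreal C * emeasure \<nu> UNIV"
  proof -
    obtain C where "C > 0" and C: "\<forall>\<sigma> \<in> locally_finite_borel_measures (halfspace :: ('a \<times> real) set).
      \<forall>u f \<nu> l. u \<in> borel_measurable \<sigma> \<longrightarrow> f \<in> borel_measurable \<sigma> \<longrightarrow>
      (\<forall>z\<in>halfspace. pp_op \<sigma> f z \<le> u z) \<longrightarrow> finite_measure \<nu> \<longrightarrow> sets \<nu> = sets borel \<longrightarrow>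
      l * (\<integral>\<^sup>+ z. indicator {z \<in> halfspace. l * u z < poisson \<nu> z} z * f z \<partial>\<sigma>) \<le> ennreal C * emeasure \<nu> UNIV"
      using weak_type_estimate[where 'a='a] by blast
    have "(\<lambda>z. epowr (u z) q) \<in> borel_measurable \<sigma>" by measurable
    with C[rule_format, OF \<sigma> u_meas, of "\<lambda>z. epowr (u z) q"] sup \<open>C > 0\<close> show ?thesis
      by (intro that[of C]) auto
  qed
  obtain W where W: "(\<integral>\<^sup>+ z. epowr (u z) q \<partial>\<sigma>) = ennreal W" "W \<ge> 0"
    using fin by (cases "\<integral>\<^sup>+ z. epowr (u z) q \<partial>\<sigma>") auto
  \<comment> \<open>The ratio of successive layers: 2^q from the height of the layer, 1/2 from the
    weak-type bound. It is below 1 exactly because q < 1.\<close>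
  define \<rho> where "\<rho> = 2 powr (q - 1)"
  have \<rho>: "0 < \<rho>" "\<rho> < 1" using q powr_less_mono[of "q - 1" 0 2] by (auto simp: \<rho>_def)
  define A where "A = W + C * 2 powr q / (1 - \<rho>)"
  have A: "A > 0" unfolding A_def using W(2) C \<rho> by (intro add_nonneg_pos divide_pos_pos mult_pos_pos) auto
  have "Lq_norm q \<sigma> (poisson \<nu>) \<le> ennreal (A powr (1 / q)) * emeasure \<nu> UNIV"
    if \<nu>: "\<nu> \<in> locally_finite_borel_measures UNIV" for \<nu> :: "'a measure"
  proof (cases "emeasure \<nu> UNIV")
    case top
    thus ?thesis using A by (simp add: ennreal_mult_top)
  next
    case (real m)
    have s: "sets \<nu> = sets borel" using locally_finite_sets[OF \<nu>] by (simp add: sets_restrict_space)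
    have sn: "space \<nu> = UNIV" using sets_eq_imp_space_eq[OF s] by simp
    have f: "finite_measure \<nu>" using real by (intro finite_measureI) (simp add: sn)
    note [measurable] = poisson_measurable[OF f s]
    \<comment> \<open>For m = 0 the levels 2^k m all collapse to 0, so this case is
      separate.\<close>
    show ?thesis
    proof (cases "m = 0")
      case True
      have "poisson \<nu> z = 0" if "z \<in> space \<sigma>" for z
        using poisson_le[OF snd_pos[OF that], of \<nu>] True real by (simp add: sn)
      hence "(\<integral>\<^sup>+ z. epowr (poisson \<nu> z) q \<partial>\<sigma>) = (\<integral>\<^sup>+ z. 0 \<partial>\<sigma>)" by (intro nn_integral_cong) simp
      thus ?thesis by (simp add: Lq_norm_def)
    next
      case False
      hence m: "m > 0" using real by simp
      define E where "E k = {z \<in> halfspace. ennreal (2 ^ k * m) * u z < poisson \<nu> z}" for k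
      have [measurable]: "E k \<in> sets \<sigma>" for k unfolding E_def sp[symmetric] by measurable
      have Eint: "(\<integral>\<^sup>+ z. indicator (E k) z * epowr (u z) q \<partial>\<sigma>) \<le> ennreal (C / 2 ^ k)" (is "?I \<le> _") for k
      proof -
        have "ennreal (1 / (2 ^ k * m)) * (ennreal (2 ^ k * m) * ?I) \<le> ennreal (1 / (2 ^ k * m)) * (ennreal C * ennreal m)"
          unfolding E_def real(2)[symmetric] by (intro mult_left_mono wt f s) auto
        also have "ennreal (1 / (2 ^ k * m)) * (ennreal C * ennreal m) = ennreal (C / 2 ^ k)"
          using m C by (simp add: ennreal_mult[symmetric])
        also have "ennreal (1 / (2 ^ k * m)) * (ennreal (2 ^ k * m) * ?I) = ?I"
          using m by (simp add: mult.assoc[symmetric] ennreal_mult[symmetric])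
        finally show ?thesis .
      qed
      let ?b = "\<lambda>k. (2 ^ Suc k * m) powr q"
      have geo: "?b k * (C / 2 ^ k) = m powr q * (C * 2 powr q) * \<rho> ^ k" for k
      proof -
        have "?b k = 2 powr (real (Suc k) * q) * m powr q"
          using m by (simp add: powr_mult powr_realpow[symmetric] powr_powr del: power_Suc of_nat_Suc)
        moreover have "\<rho> ^ k = 2 powr (real k * q) / 2 ^ k"
          by (simp add: \<rho>_def powr_realpow[symmetric] powr_powr powr_diff[symmetric] algebra_simps)
        moreover have "2 powr (real (Suc k) * q) = 2 powr q * 2 powr (real k * q)"
          by (simp add: powr_add[symmetric] algebra_simps)
        ultimately show ?thesis by simp
      qed
      have "(\<integral>\<^sup>+ z. epowr (poisson \<nu> z) q \<partial>\<sigma>) \<le>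
          (\<integral>\<^sup>+ z. ennreal (m powr q) * epowr (u z) q + (\<Sum>k. ennreal (?b k) * (indicator (E k) z * epowr (u z) q)) \<partial>\<sigma>)"
      proof (intro nn_integral_mono)
        fix z assume z: "z \<in> space \<sigma>"
        have "poisson \<nu> z < \<infinity>"
          by (rule order_le_less_trans[OF poisson_le[OF snd_pos[OF z]]])
            (simp add: sn real(2) ennreal_mult_less_top)
        hence "epowr (poisson \<nu> z) q \<le> ennreal (m powr q) * epowr (u z) q +
            (\<Sum>k. ennreal (?b k) * (if ennreal (2 ^ k * m) * u z < poisson \<nu> z then epowr (u z) q else 0))"
          using u z sp by (intro epowr_le_dyadic_sum q m) auto
        also have "(\<lambda>k. if ennreal (2 ^ k * m) * u z < poisson \<nu> z then epowr (u z) q else 0)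
            = (\<lambda>k. indicator (E k) z * epowr (u z) q)"
          using z sp by (auto simp: E_def fun_eq_iff)
        finally show "epowr (poisson \<nu> z) q \<le> ennreal (m powr q) * epowr (u z) q
            + (\<Sum>k. ennreal (?b k) * (indicator (E k) z * epowr (u z) q))" .
      qed
      also have "\<dots> = ennreal (m powr q) * ennreal W
          + (\<Sum>k. ennreal (?b k) * (\<integral>\<^sup>+ z. indicator (E k) z * epowr (u z) q \<partial>\<sigma>))"
        by (subst nn_integral_add, measurable) (simp add: nn_integral_suminf nn_integral_cmult W(1)[symmetric])
      also have "\<dots> \<le> ennreal (m powr q) * ennreal W + (\<Sum>k. ennreal (m powr q * (C * 2 powr q) * \<rho> ^ k))"
      proof (intro add_left_mono suminf_le summableI)
        fix k
        have "ennreal (?b k) * (\<integral>\<^sup>+ z. indicator (E k) z * epowr (u z) q \<partial>\<sigma>) \<le> ennreal (?b k) * ennreal (C / 2 ^ k)"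
          by (intro mult_left_mono Eint) simp
        also have "\<dots> = ennreal (?b k * (C / 2 ^ k))" using C by (intro ennreal_mult[symmetric]) auto
        also have "\<dots> = ennreal (m powr q * (C * 2 powr q) * \<rho> ^ k)" by (simp only: geo)
        finally show "ennreal (?b k) * (\<integral>\<^sup>+ z. indicator (E k) z * epowr (u z) q \<partial>\<sigma>)
            \<le> ennreal (m powr q * (C * 2 powr q) * \<rho> ^ k)" .
      qed
      also have "(\<Sum>k. ennreal (m powr q * (C * 2 powr q) * \<rho> ^ k)) = ennreal (m powr q * (C * 2 powr q) * (1 / (1 - \<rho>)))"
      proof (rule suminf_ennreal_eq)
        show "(\<lambda>k. m powr q * (C * 2 powr q) * \<rho> ^ k) sums (m powr q * (C * 2 powr q) * (1 / (1 - \<rho>)))"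
          using \<rho> by (intro sums_mult geometric_sums) simp
      qed (use C \<rho> in simp)
      also have "ennreal (m powr q) * ennreal W + \<dots> = ennreal (m powr q * A)"
        using W(2) C \<rho> by (simp add: A_def ennreal_mult[symmetric] ennreal_plus[symmetric] algebra_simps del: ennreal_plus)
      finally have "Lq_norm q \<sigma> (poisson \<nu>) \<le> epowr (ennreal (m powr q * A)) (1 / q)"
        unfolding Lq_norm_def using q by (intro epowr_mono) auto
      also have "\<dots> = ennreal (A powr (1 / q)) * emeasure \<nu> UNIV"
        using q m A unfolding real(2) by (simp add: powr_mult powr_powr ennreal_mult[symmetric] mult.commute)
      finally show ?thesis .
    qed
  qed
  thus ?thesis unfolding poisson_trace_ineq_def using A by (intro exI[of _ "A powr (1 / q)"]) auto
qed

text \<open>Choosing C before \<sigma> expresses that \<open>c\<^sub>0\<close> depends on q and the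
  dimension only. Positivity of the limit is stated for nonzero \<sigma>, since for \<sigma> = 0 all
  iterates vanish.\<close>

theorem theorem4p1:
  fixes q :: real
  assumes "0 < q" and "q < 1"
  shows "(\<forall>\<sigma> \<in> locally_finite_borel_measures (halfspace :: ('a::euclidean_space \<times> real) set).
            (\<exists>\<kappa>>0. poisson_trace_ineq q \<sigma> \<kappa>) \<longleftrightarrow>
            (\<exists>u. (\<forall>z\<in>halfspace. 0 < u z \<and> u z < \<infinity>) \<and> in_Lq q \<sigma> u \<and>
                 (\<forall>z\<in>halfspace. u z \<ge> poisson_poisson_adj (power_measure q \<sigma> u) z)))
       \<and> (\<exists>C>0. \<forall>c\<^sub>0. 0 < c\<^sub>0 \<and> c\<^sub>0 \<le> C \<longrightarrow>
            (\<forall>\<sigma> \<in> locally_finite_borel_measures (halfspace :: ('a \<times> real) set).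
               (\<exists>\<kappa>>0. poisson_trace_ineq q \<sigma> \<kappa>) \<longrightarrow>
               (\<forall>j. \<forall>z\<in>halfspace. poisson_iter q \<sigma> c\<^sub>0 j z \<le> poisson_iter q \<sigma> c\<^sub>0 (Suc j) z) \<and>
               (\<exists>u. (\<forall>z\<in>halfspace. (\<lambda>j. poisson_iter q \<sigma> c\<^sub>0 j z) \<longlonglongrightarrow> u z) \<and>
                    (\<forall>z\<in>halfspace. u z < \<infinity>) \<and>
                    (emeasure \<sigma> halfspace \<noteq> 0 \<longrightarrow> (\<forall>z\<in>halfspace. 0 < u z)) \<and>
                    in_Lq q \<sigma> u \<and>
                    (\<forall>z\<in>halfspace. u z = poisson_poisson_adj (power_measure q \<sigma> u) z) \<and>
                    (\<forall>z\<in>halfspace.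
                       u z \<ge> ennreal c\<^sub>0 * epowr (poisson_poisson_adj \<sigma> z) (1 / (1 - q))))))"
    (is "(\<forall>\<sigma>\<in>?L. ?trace \<sigma> \<longleftrightarrow> ?super \<sigma>) \<and> (\<exists>C>0. \<forall>c\<^sub>0. 0 < c\<^sub>0 \<and> c\<^sub>0 \<le> C \<longrightarrow>
      (\<forall>\<sigma>\<in>?L. ?trace \<sigma> \<longrightarrow> ?sol c\<^sub>0 \<sigma>))")
proof -
  have "q / (1 - q) > 0" using assms by simp
  from pp_op_power_lower_bound[OF this, where 'a='a] obtain c where c: "c > 0" and
    lb: "\<And>(M :: ('a \<times> real) measure) z. halfspace_measure M \<Longrightarrow> snd z > 0 \<Longrightarrow>
      ennreal c * epowr (pp_op M (\<lambda>_. 1) z) (1 + q / (1 - q)) \<le> pp_op M (\<lambda>w. epowr (pp_op M (\<lambda>_. 1) w) (q / (1 - q))) z"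
    by blast
  \<comment> \<open>Chosen so that \<open>C powr (1 - q) = c\<close>; every
    \<open>c\<^sub>0 \<le> C\<close> then satisfies the condition that makes the iteration
    increase.\<close>
  define C where "C = c powr (1 / (1 - q))"
  have C: "C > 0" using c by (simp add: C_def)
  have sol: "?sol c\<^sub>0 \<sigma>" if c0: "0 < c\<^sub>0" "c\<^sub>0 \<le> C" and \<sigma>: "\<sigma> \<in> ?L" and tr: "?trace \<sigma>" for c\<^sub>0 \<sigma>
  proof -
    obtain \<kappa> where \<kappa>: "\<kappa> > 0" "poisson_trace_ineq q \<sigma> \<kappa>" using tr by blast
    have "c\<^sub>0 powr (1 - q) \<le> C powr (1 - q)" using c0 assms by (intro powr_mono2) auto
    also have "\<dots> = c" using c assms by (simp add: C_def powr_powr)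
    finally have c1: "c\<^sub>0 powr (1 - q) \<le> c" .
    interpret poisson_iteration \<sigma> q \<kappa> c c\<^sub>0
      unfolding poisson_iteration_def poisson_iteration_axioms_def
      using assms \<sigma> \<kappa> c0 c1 lb halfspace_measure_locally_finite[OF \<sigma>] by blast
    show ?thesis
      using iter_le_Suc limit_tendsto limit_finite limit_pos limit_in_Lq limit_solution u0_le_limit
      by blast
  qed
  have equiv: "?trace \<sigma> \<longleftrightarrow> ?super \<sigma>" if \<sigma>: "\<sigma> \<in> ?L" for \<sigma>
  proof
    interpret halfspace_measure \<sigma> by (rule halfspace_measure_locally_finite[OF \<sigma>])
    assume tr: "?trace \<sigma>"
    show "?super \<sigma>"
    proof (cases "emeasure \<sigma> halfspace = 0")
      case False
      thus ?thesis using sol[OF C order_refl \<sigma> tr] by (metis order_refl)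
    next
      case True
      \<comment> \<open>For \<sigma> = 0 the constructed solution is 0 and not positive, so the
        constant 1 is the witness.\<close>
      have "emeasure \<sigma> (space \<sigma>) = 0" using True locally_finite_space[OF \<sigma>] by simp
      hence bot: "ae_filter \<sigma> = bot" by (simp add: ae_filter_eq_bot_iff)
      have zero: "(\<integral>\<^sup>+ w. F w \<partial>\<sigma>) = 0" for F
        using nn_integral_cong_AE[of F "\<lambda>_. 0" \<sigma>] unfolding bot by simp
      have "poisson_poisson_adj (power_measure q \<sigma> (\<lambda>_. 1)) z = 0" for z
        unfolding power_measure_def by (subst poisson_poisson_adj_density) (auto simp: pp_op_def zero)
      moreover have "in_Lq q \<sigma> (\<lambda>_. 1)"
        unfolding in_Lq_def Lq_norm_def zero by simp
      ultimately show ?thesis by (intro exI[of _ "\<lambda>_. 1"]) simp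
    qed
  next
    interpret halfspace_measure \<sigma> by (rule halfspace_measure_locally_finite[OF \<sigma>])
    assume "?super \<sigma>"
    then obtain u where u: "\<forall>z\<in>halfspace. 0 < u z \<and> u z < \<infinity>" "in_Lq q \<sigma> u"
      "\<forall>z\<in>halfspace. u z \<ge> poisson_poisson_adj (power_measure q \<sigma> u) z" by blast
    have [measurable]: "u \<in> borel_measurable \<sigma>" using u(2) by (simp add: in_Lq_def)
    have fin: "(\<integral>\<^sup>+ z. epowr (u z) q \<partial>\<sigma>) < \<infinity>"
      using u(2) unfolding in_Lq_def Lq_norm_def by (simp only: epowr_lt_top_iff)
    have "poisson_poisson_adj (power_measure q \<sigma> u) = pp_op \<sigma> (\<lambda>w. epowr (u w) q)"
      unfolding power_measure_def by (rule poisson_poisson_adj_density) measurable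
    thus "?trace \<sigma>"
      using u(3) by (intro supersolution_imp_trace_ineq[OF assms \<sigma> _ u(1) fin]) auto
  qed
  have "\<exists>C>0. \<forall>c\<^sub>0. 0 < c\<^sub>0 \<and> c\<^sub>0 \<le> C \<longrightarrow> (\<forall>\<sigma>\<in>?L. ?trace \<sigma> \<longrightarrow> ?sol c\<^sub>0 \<sigma>)"
  proof (intro exI[of _ C] conjI allI impI)
    show "C > 0" by (rule C)
    fix c\<^sub>0 assume c0: "0 < c\<^sub>0 \<and> c\<^sub>0 \<le> C"
    show "\<forall>\<sigma>\<in>?L. ?trace \<sigma> \<longrightarrow> ?sol c\<^sub>0 \<sigma>"
      by (rule ballI, rule impI, rule sol[OF conjunct1[OF c0] conjunct2[OF c0]])
  qed
  thus ?thesis by (intro conjI[OF ballI[OF equiv]])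
qed

end
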